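(* Let $N=2$, $k>0$, $f(u)=e^u$, $V_k(r)=\dfrac{1}{r^2(-\log(r/e))^{2+k}}$. Then the bifurcation diagram of $$-\Delta u=\lambda V_k(|x|)f(u)\ \text{ in } B_1,\qquad u>0\ \text{ in } B_1,\qquad u=0\ \text{ on }\partial B_1 \qquad (P)$$ is of (i) Type I if $k>\frac14$; (ii) Type II if $k\le\frac14$. Moreover, $\lambda$ is globally parameterized by $\alpha$ if $k\le\frac14$.
   Context: $B_1\subset\mathbb{R}^2$ is the open unit ball. A radial solution of $(P)$ is a pair $(\lambda,u)$ with $\lambda>0$, $u$ radial, continuous on $[0,1]$ in $r=|x|$, $C^2$ on $(0,1]$, satisfying $(P)$ (the equation pointwise for $0<r<1$). For every $\beta\in\mathbb{R}$ there is exactly one radial solution with $u(0)+\log\lambda=\beta$; denote its $\lambda$ by $\lambda(\beta)$ and set $\alpha(\beta):=u(0)=\lVert u\rVert_{L^\infty(B_1)}=\beta-\log\lambda(\beta)$. The bifurcation curve is $\{(\lambda(\beta),\alpha(\beta));\beta\in\mathbb{R}\}$; it is a real analytic unbounded curve emanating from $(0,0)$ (the limit as $\beta\to-\infty$). A point $(\lambda(\beta),\alpha(\beta))$ is a turning point if $\beta$ is a local extremum point of $\lambda(\cdot)$. Type I: the curve emanating from $(0,0)$ turns infinitely many times around $\lambda=\lambda_*$ for some $\lambda_*>0$ (that is, $\lambda(\beta)-\lambda_*$ changes sign infinitely many times, giving infinitely many turning points), and the curve converges to $\lambda=\lambda_*$ as $\alpha\to\infty$. Type II: the curve emanating from $(0,0)$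 converges monotonically to $\lambda=\lambda_*$ for some $\lambda_*>0$ as $\alpha\to\infty$ (that is, $\lambda(\beta)$ is monotone along the curve, with no turning points). "$\lambda$ is globally parameterized by $\alpha$" means that the whole curve is the graph of a function $\alpha\mapsto\lambda$. *)

theory Defs
  imports "HOL-Analysis.Analysis"
begin

section \<open>The boundary value problem on the unit disc\<close>

definition laplacian :: "('a::euclidean_space \<Rightarrow> real) \<Rightarrow> 'a \<Rightarrow> real" where
  "laplacian u x = (\<Sum>b\<in>Basis. (deriv ^^ 2) (\<lambda>t. u (x + t *\<^sub>R b)) 0)"

text \<open>Derivatives are taken within \<open>S\<close>, hence are one-sided at an endpoint that belongs to \<open>S\<close>.\<close>

definition C2_on :: "real set \<Rightarrow> (real \<Rightarrow> real) \<Rightarrow> bool" where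
  "C2_on S \<phi> \<longleftrightarrow> (\<exists>\<phi>' \<phi>''.
     (\<forall>r\<in>S. (\<phi> has_real_derivative \<phi>' r) (at r within S)) \<and>
     (\<forall>r\<in>S. (\<phi>' has_real_derivative \<phi>'' r) (at r within S)) \<and>
     continuous_on S \<phi>'')"

text \<open>
  The solution need not be differentiable at the origin, where \<open>V\<close> may be singular, so the
  equation is imposed on the punctured disc only.  The values of \<open>u\<close> outside the closed unit
  disc are irrelevant.
\<close>

definition radial_solution ::
  "(real \<Rightarrow> real) \<Rightarrow> (real \<Rightarrow> real) \<Rightarrow> real \<Rightarrow> (real^2 \<Rightarrow> real) \<Rightarrow> bool" where
  "radial_solution V f l u \<longleftrightarrow>
     0 < l \<and>
     (\<exists>\<phi>. (\<forall>x\<in>cball 0 1. u x = \<phi> (norm x)) \<and> continuous_on {0..1} \<phi> \<and> C2_on {0<..1} \<phi>) \<and>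
     (\<forall>x\<in>ball 0 1 - {0}. - laplacian u x = l * V (norm x) * f (u x)) \<and>
     (\<forall>x\<in>ball 0 1. 0 < u x) \<and>
     (\<forall>x\<in>sphere 0 1. u x = 0)"

definition V_weight :: "real \<Rightarrow> real \<Rightarrow> real" where
  "V_weight k r = 1 / (r^2 * (- ln (r / exp 1)) powr (2 + k))"

section \<open>The bifurcation curve\<close>

text \<open>
  The parameter is \<open>\<beta> = u 0 + ln l\<close>.  For \<open>f = exp\<close> and \<open>V = V_weight k\<close> with \<open>k > 0\<close> every
  real \<open>\<beta>\<close> is attained by exactly one radial solution (unique on the closed disc), so that both
  descriptions below denote.
\<close>

definition bif_lambda :: "(real \<Rightarrow> real) \<Rightarrow> (real \<Rightarrow> real) \<Rightarrow> real \<Rightarrow> real" where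
  "bif_lambda V f \<beta> = (THE l. \<exists>u. radial_solution V f l u \<and> u 0 + ln l = \<beta>)"

definition bif_alpha :: "(real \<Rightarrow> real) \<Rightarrow> (real \<Rightarrow> real) \<Rightarrow> real \<Rightarrow> real" where
  "bif_alpha V f \<beta> = (THE a. \<exists>l u. radial_solution V f l u \<and> u 0 + ln l = \<beta> \<and> a = u 0)"

section \<open>Shape of a parameterized curve \<open>\<beta> \<mapsto> (L \<beta>, A \<beta>)\<close>\<close>

definition local_extremum :: "(real \<Rightarrow> real) \<Rightarrow> real \<Rightarrow> bool" where
  "local_extremum g b \<longleftrightarrow>
     (\<forall>\<^sub>F x in nhds b. g x \<le> g b) \<or> (\<forall>\<^sub>F x in nhds b. g b \<le> g x)"

definition turning_points :: "(real \<Rightarrow> real) \<Rightarrow> (real \<Rightarrow> real) \<Rightarrow> (real \<times> real) set" where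
  "turning_points L A = {(L \<beta>, A \<beta>) | \<beta>. local_extremum L \<beta>}"

definition changes_sign_infinitely_often :: "(real \<Rightarrow> real) \<Rightarrow> bool" where
  "changes_sign_infinitely_often g \<longleftrightarrow>
     (\<exists>s::nat \<Rightarrow> real. strict_mono s \<and> (\<forall>n. g (s n) * g (s (Suc n)) < 0))"

definition emanates_from_origin :: "(real \<Rightarrow> real) \<Rightarrow> (real \<Rightarrow> real) \<Rightarrow> bool" where
  "emanates_from_origin L A \<longleftrightarrow> (L \<longlongrightarrow> 0) at_bot \<and> (A \<longlongrightarrow> 0) at_bot"

text \<open>
  \<open>L \<rightarrow> l\<close> as \<open>A \<rightarrow> \<infinity>\<close>: the filter \<open>filtercomap A at_top\<close> is generated by the
  sets \<open>{\<beta>. M \<le> A \<beta>}\<close>, and the first conjunct excludes the vacuous case of bounded \<open>A\<close>.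
\<close>

definition converges_to_line :: "(real \<Rightarrow> real) \<Rightarrow> (real \<Rightarrow> real) \<Rightarrow> real \<Rightarrow> bool" where
  "converges_to_line L A l \<longleftrightarrow>
     filterlim A at_top at_top \<and> (L \<longlongrightarrow> l) (filtercomap A at_top)"

definition type_I :: "(real \<Rightarrow> real) \<Rightarrow> (real \<Rightarrow> real) \<Rightarrow> bool" where
  "type_I L A \<longleftrightarrow> emanates_from_origin L A \<and>
     (\<exists>l>0. changes_sign_infinitely_often (\<lambda>\<beta>. L \<beta> - l) \<and>
            infinite (turning_points L A) \<and>
            converges_to_line L A l)"

definition type_II :: "(real \<Rightarrow> real) \<Rightarrow> (real \<Rightarrow> real) \<Rightarrow> bool" where
  "type_II L A \<longleftrightarrow> emanates_from_origin L A \<and>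
     (\<exists>l>0. (mono L \<or> antimono L) \<and>
            turning_points L A = {} \<and>
            converges_to_line L A l)"

definition globally_parameterized_by_alpha :: "(real \<Rightarrow> real) \<Rightarrow> (real \<Rightarrow> real) \<Rightarrow> bool" where
  "globally_parameterized_by_alpha L A \<longleftrightarrow>
     (\<exists>h D. range (\<lambda>\<beta>. (L \<beta>, A \<beta>)) = {(h a, a) | a. a \<in> D})"

end

theory Submission
  imports Defs
begin

text \<open>
  With \<open>s = 1 - ln r\<close> and \<open>z = u + ln \<lambda>\<close> the radial problem becomes \<open>z'' = - s\<^sup>-\<^sup>2\<^sup>-\<^sup>k e\<^sup>z\<close> on
  \<open>s > 1\<close> with \<open>z(1) = ln \<lambda>\<close> and \<open>z(\<infinity>) = \<beta>\<close>.  This equation is invariant under scaling of \<open>s\<close>, so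
  its solution \<open>z\<close> on \<open>(0, \<infinity>)\<close> with \<open>z(\<infinity>) = 0\<close> gives the whole curve:
  \<open>ln \<lambda>(\<beta>) = z(e\<^bsup>-\<beta>/k\<^esup>) + \<beta>\<close> and \<open>\<alpha>(\<beta>) = - z(e\<^bsup>-\<beta>/k\<^esup>)\<close>.  In the time \<open>t = \<beta> / k\<close> the function
  \<open>w = ln (\<lambda> / k)\<close> solves the damped oscillator equation \<open>w'' + w' + k (e\<^sup>w - 1) = 0\<close>, whose
  equilibrium \<open>0\<close> attracts and is a focus for \<open>k > 1/4\<close> and a node for \<open>k \<le> 1/4\<close>; hence \<open>\<lambda>\<^sub>* = k\<close>.
\<close>

section \<open>Comparison arguments on the real line\<close>

text \<open>The roots of m^2 + m + k explain the threshold 1/4, but linearization only sees the end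
  of the curve, whereas monotonicity concerns all of it. Both regimes are read off from p(t) = w(t)
  exp(t/2), for which p'' = (w/4 - k (exp w - 1)) exp(t/2). If k > 1/4 and w is close to 0, then p''
  <= - d p wherever p >= 0, and likewise for -p, so neither sign of w persists. If k <= 1/4, then p
  is concave as long as w < 0; it starts out negative and decreasing, so it never reaches 0. Since
  \<open>bif_lambda\<close> is a definite description, a profile must exist and be determined by its
  limit. That limit is a datum at s = infinity, out of reach of initial value theorems at finite
  points. Both facts come from integrating twice from infinity: z(s) = b - (integral over t > s of
  (t - s) t^(-2-k) exp(z(t))). For b = 0, x = s^(-k) and t^(-k) = x r this reads G(x) = - (x/k)
  (integral over 0 < r < 1 of (1 - r^(1/k)) exp(G(x r))), which is regular at x = 0 and is the
  origin of \<open>picard\<close>.\<close>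

lemma exp_minus_one_ge: "x \<le> exp x - (1::real)"
  using exp_ge_add_one_self[of x] by linarith

text \<open>The tangent of exp at x lies below exp at 0. This bounds the potential by w times the
  restoring force.\<close>

lemma mult_exp_diff_ge: "exp x - 1 - x \<le> x * (exp x - (1::real))"
proof -
  have "exp x * (1 - x) \<le> exp x * exp (- x)"
    using exp_minus_one_ge[of "- x"] by (intro mult_left_mono) auto
  then show ?thesis by (simp add: exp_minus algebra_simps)
qed

text \<open>Expanding the square leaves the tangent bound for exp (x / 2). The square is an explicit
  lower bound for the potential, so small energy forces w close to 0 from either side.\<close>

lemma exp_half_minus_one_squared_le: "(exp (x / 2) - 1)\<^sup>2 \<le> exp x - 1 - (x::real)"
proof -
  have "(exp (x / 2))\<^sup>2 = exp x"
    by (simp flip: exp_of_nat_mult add: power2_eq_square exp_add[symmetric])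
  then have "(exp (x / 2) - 1)\<^sup>2 = exp x - 2 * exp (x / 2) + 1"
    by (simp add: power2_diff)
  then show ?thesis
    using exp_minus_one_ge[of "x / 2"] by linarith
qed

lemma le_tangent:
  fixes f f' :: "real \<Rightarrow> real"
  assumes "\<And>x. a \<le> x \<Longrightarrow> (f has_real_derivative f' x) (at x)"
    and "\<And>x. a \<le> x \<Longrightarrow> f' x \<le> c" and "a \<le> b"
  shows "f b \<le> f a + c * (b - a)"
proof -
  have "f b - c * b \<le> f a - c * a"
  proof (rule DERIV_nonpos_imp_nonincreasing[where f="\<lambda>x. f x - c * x", OF assms(3)])
    fix x assume "a \<le> x" "x \<le> b"
    then show "\<exists>y. DERIV (\<lambda>x. f x - c * x) x :> y \<and> y \<le> 0"
      using assms(2)[of x]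
      by (intro exI[of _ "f' x - c"] conjI) (auto intro!: derivative_eq_intros assms(1))
  qed
  then show ?thesis by (simp add: algebra_simps)
qed

lemma tangent_le:
  fixes f f' :: "real \<Rightarrow> real"
  assumes "\<And>x. a \<le> x \<Longrightarrow> (f has_real_derivative f' x) (at x)"
    and "\<And>x. a \<le> x \<Longrightarrow> c \<le> f' x" and "a \<le> b"
  shows "f a + c * (b - a) \<le> f b"
  using le_tangent[of a "\<lambda>x. - f x" "\<lambda>x. - f' x" "- c" b] assms
  by (force intro!: derivative_eq_intros)

text \<open>Here p is concave, and a concave function bounded below on a half-line is nondecreasing.
  A positive value would thus persist, keep p'' below a negative constant and drive p' below
  0.\<close>

lemma Sturm_nonneg_imp_zero:
  fixes p p' p'' :: "real \<Rightarrow> real"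
  assumes p: "\<And>t. T \<le> t \<Longrightarrow> (p has_real_derivative p' t) (at t)"
    and p': "\<And>t. T \<le> t \<Longrightarrow> (p' has_real_derivative p'' t) (at t)"
    and p'': "\<And>t. T \<le> t \<Longrightarrow> p'' t \<le> - d * p t"
    and "d > 0" and nonneg: "\<And>t. T \<le> t \<Longrightarrow> 0 \<le> p t" and "T \<le> t"
  shows "p t = 0"
proof -
  have p''_nonpos: "p'' t \<le> 0" if "T \<le> t" for t
    using p''[OF that] nonneg[OF that] \<open>d > 0\<close>
    by (smt (verit) mult_nonneg_nonneg mult_minus_left)
  have p'_nonneg: "0 \<le> p' t" if "T \<le> t" for t
  proof (rule ccontr)
    assume "\<not> 0 \<le> p' t"
    have anti: "p' x \<le> p' t" if "t \<le> x" for x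
      using le_tangent[of t p' p'' 0 x] p' p''_nonpos \<open>T \<le> t\<close> that by auto
    define x where "x = t + (p t + 1) / (- p' t)"
    have "t \<le> x" using \<open>\<not> 0 \<le> p' t\<close> nonneg[OF \<open>T \<le> t\<close>] by (auto simp: x_def divide_nonneg_neg field_simps)
    have "p x \<le> p t + p' t * (x - t)"
      using le_tangent[of t p p' "p' t" x] p anti \<open>T \<le> t\<close> \<open>t \<le> x\<close> by auto
    also have "\<dots> = -1" using \<open>\<not> 0 \<le> p' t\<close> by (simp add: x_def)
    finally show False using nonneg[of x] \<open>T \<le> t\<close> \<open>t \<le> x\<close> by auto
  qed
  show ?thesis
  proof (rule ccontr)
    assume "p t \<noteq> 0"
    then have "p t > 0" using nonneg[OF \<open>T \<le> t\<close>] by auto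
    have mono: "p t \<le> p x" if "t \<le> x" for x
      using tangent_le[of t p p' 0 x] p p'_nonneg \<open>T \<le> t\<close> that by auto
    have le: "p'' x \<le> - d * p t" if "t \<le> x" for x
    proof -
      have "p'' x \<le> - d * p x" using p'' \<open>T \<le> t\<close> that by simp
      moreover have "d * p t \<le> d * p x"
        using mono[OF that] \<open>d > 0\<close> by simp
      ultimately show ?thesis by simp
    qed
    define x where "x = t + (p' t + 1) / (d * p t)"
    have "t \<le> x" using \<open>p t > 0\<close> \<open>d > 0\<close> p'_nonneg[OF \<open>T \<le> t\<close>] by (simp add: x_def)
    have "p' x \<le> p' t + (- d * p t) * (x - t)"
      using le_tangent[of t p' p'' "- d * p t" x] p' le \<open>T \<le> t\<close> \<open>t \<le> x\<close> by auto
    also have "\<dots> = -1" using \<open>p t > 0\<close> \<open>d > 0\<close> by (simp add: x_def)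
    finally show False using p'_nonneg[of x] \<open>T \<le> t\<close> \<open>t \<le> x\<close> by auto
  qed
qed

text \<open>A concave z stays below its tangents, so a negative slope would send it to minus
  infinity. The slope is also at most the increment over the preceding unit interval, which tends to
  0.\<close>

lemma concave_tendsto:
  fixes z z' z'' :: "real \<Rightarrow> real"
  assumes z: "\<And>s. a < s \<Longrightarrow> (z has_real_derivative z' s) (at s)"
    and z': "\<And>s. a < s \<Longrightarrow> (z' has_real_derivative z'' s) (at s)"
    and neg: "\<And>s. a < s \<Longrightarrow> z'' s < 0"
    and lim: "(z \<longlongrightarrow> b) at_top"
  shows "\<And>s. a < s \<Longrightarrow> 0 < z' s" and "(z' \<longlongrightarrow> 0) at_top"
proof -
  have anti: "z' y < z' x" if "a < x" "x < y" for x y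
    using that by (intro DERIV_neg_imp_decreasing[of x y z']) (metis neg order_less_le_trans z')+
  have nonneg: "0 \<le> z' s" if "a < s" for s
  proof (rule ccontr)
    assume "\<not> 0 \<le> z' s"
    have bound: "z x \<le> z s + z' s * (x - s)" if "s \<le> x" for x
    proof (rule le_tangent[of s z z', OF _ _ that])
      fix y assume "s \<le> y"
      then show "(z has_real_derivative z' y) (at y)" using \<open>a < s\<close> by (intro z) auto
      show "z' y \<le> z' s" using anti[of s y] \<open>a < s\<close> \<open>s \<le> y\<close> by (cases "y = s") auto
    qed
    have "\<forall>\<^sub>F x in at_top. b - 1 < z x" using order_tendstoD(1)[OF lim] by simp
    then obtain N where N: "\<And>x. N \<le> x \<Longrightarrow> b - 1 < z x"
      by (auto simp: eventually_at_top_linorder)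
    \<comment> \<open>Far enough for the tangent at s to have dropped to b - 1, and beyond
      \<open>N\<close>, where z exceeds b - 1.\<close>
    define x where "x = max (max N s) (s + (z s - b + 1) / - z' s)"
    have "z' s * (x - s) \<le> z' s * ((z s - b + 1) / - z' s)"
      using \<open>\<not> 0 \<le> z' s\<close> by (intro mult_left_mono_neg) (auto simp: x_def)
    also have "\<dots> = b - 1 - z s" using \<open>\<not> 0 \<le> z' s\<close> by simp
    finally have "z' s * (x - s) \<le> b - 1 - z s" .
    moreover have "s \<le> x" "N \<le> x" by (auto simp: x_def)
    ultimately show False using bound[of x] N[of x] by linarith
  qed
  show "0 < z' s" if "a < s" for s
    using nonneg[of "s + 1"] anti[of s "s + 1"] that by auto
  have "((\<lambda>s. z (- 1 + s)) \<longlongrightarrow> b) at_top"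
    by (rule filterlim_compose[OF lim
          filterlim_tendsto_add_at_top[OF tendsto_const filterlim_ident]])
  then have "((\<lambda>s. z (s - 1)) \<longlongrightarrow> b) at_top" by simp
  from tendsto_diff[OF lim this] have lim_diff: "((\<lambda>s. z s - z (s - 1)) \<longlongrightarrow> 0) at_top" by simp
  have le: "z' s \<le> z s - z (s - 1)" if "a + 1 < s" for s
  proof -
    have "\<exists>c>s - 1. c < s \<and> z s - z (s - 1) = (s - (s - 1)) * z' c"
      using that by (intro MVT2) (auto intro!: z)
    then show ?thesis using that anti by (force simp: less_imp_le)
  qed
  have "\<forall>\<^sub>F s in at_top. 0 \<le> z' s"
    using eventually_mono[OF eventually_gt_at_top nonneg] .
  moreover have "\<forall>\<^sub>F s in at_top. z' s \<le> z s - z (s - 1)"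
    using eventually_mono[OF eventually_gt_at_top le] .
  ultimately show "(z' \<longlongrightarrow> 0) at_top"
    by (rule tendsto_sandwich[OF _ _ tendsto_const lim_diff])
qed

text \<open>Integration from s to infinity without improper integrals: f + g and - f + g are
  nonincreasing, g is nonnegative and f vanishes at infinity.\<close>

lemma abs_le_of_abs_deriv_le:
  fixes f f' g g' :: "real \<Rightarrow> real"
  assumes f: "\<And>s. a < s \<Longrightarrow> (f has_real_derivative f' s) (at s)"
    and g: "\<And>s. a < s \<Longrightarrow> (g has_real_derivative g' s) (at s)"
    and le: "\<And>s. a < s \<Longrightarrow> \<bar>f' s\<bar> \<le> - g' s"
    and f_lim: "(f \<longlongrightarrow> 0) at_top" and g_nonneg: "\<And>s. a < s \<Longrightarrow> 0 \<le> g s" and "a < s"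
  shows "\<bar>f s\<bar> \<le> g s"
proof -
  have "0 \<le> h s + g s"
    if h: "\<And>s. a < s \<Longrightarrow> (h has_real_derivative h' s) (at s)"
      and h_le: "\<And>s. a < s \<Longrightarrow> \<bar>h' s\<bar> \<le> - g' s" and h_lim: "(h \<longlongrightarrow> 0) at_top"
    for h h' :: "real \<Rightarrow> real"
  proof (rule tendsto_upperbound[OF h_lim])
    have "h x \<le> h s + g s" if "s \<le> x" for x
    proof -
      have "h x + g x \<le> h s + g s"
      proof (rule DERIV_nonpos_imp_nonincreasing[where f="\<lambda>x. h x + g x", OF that])
        fix y assume "s \<le> y" "y \<le> x"
        then have "a < y" using \<open>a < s\<close> by simp
        then show "\<exists>d. DERIV (\<lambda>x. h x + g x) y :> d \<and> d \<le> 0"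
          using h_le[of y] by (intro exI[of _ "h' y + g' y"] conjI DERIV_add h g) auto
      qed
      then show ?thesis using g_nonneg[of x] \<open>a < s\<close> that by simp
    qed
    then show "\<forall>\<^sub>F x in at_top. h x \<le> h s + g s"
      by (rule eventually_mono[OF eventually_ge_at_top])
  qed simp
  from this[OF f le f_lim] this[of "\<lambda>s. - f s" "\<lambda>s. - f' s"]
  show ?thesis using f le tendsto_minus[OF f_lim] by (force intro: DERIV_minus)
qed

lemma exp_diff_le:
  fixes x y :: real
  assumes "x \<le> b" "y \<le> b"
  shows "\<bar>exp x - exp y\<bar> \<le> exp b * \<bar>x - y\<bar>"
  using assms
proof (induction x y rule: linorder_wlog)
  case (le x y)
  have "exp y * (1 - exp (x - y)) \<le> exp b * (y - x)"
    using le exp_minus_one_ge[of "x - y"] by (intro mult_mono) auto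
  then show ?case using le by (simp add: exp_diff algebra_simps)
next
  case (sym x y)
  then show ?case by (simp add: abs_minus_commute)
qed

section \<open>The damped oscillator\<close>

locale damped_oscillator =
  fixes k :: real and w w' :: "real \<Rightarrow> real"
  assumes k_pos: "k > 0"
    and w_deriv: "\<And>t. (w has_real_derivative w' t) (at t)"
    and w'_deriv: "\<And>t. (w' has_real_derivative - w' t - k * (exp (w t) - 1)) (at t)"
begin

section \<open>Dissipation of energy and convergence to the equilibrium\<close>

definition energy :: "real \<Rightarrow> real" where
  "energy t = (w' t)\<^sup>2 / 2 + k * (exp (w t) - 1 - w t)"

lemma potential_nonneg: "0 \<le> k * (exp (w t) - 1 - w t)"
  using exp_minus_one_ge[of "w t"] k_pos by (intro mult_nonneg_nonneg) auto

lemma energy_nonneg: "0 \<le> energy t"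
  using potential_nonneg[of t] by (simp add: energy_def)

lemma energy_deriv: "(energy has_real_derivative - (w' t)\<^sup>2) (at t)"
  unfolding energy_def
  by (auto intro!: derivative_eq_intros w_deriv w'_deriv simp: power2_eq_square field_simps)

text \<open>The kinetic part is at most the energy, so the energy decays no faster than exp(-2t).
  This prevents w from settling at 0 in finite time.\<close>

lemma energy_pos:
  assumes "energy t0 > 0" "t0 \<le> t"
  shows "energy t > 0"
proof -
  have "energy t0 * exp (2 * t0) \<le> energy t * exp (2 * t)"
  proof (rule DERIV_nonneg_imp_nondecreasing[where f="\<lambda>x. energy x * exp (2 * x)", OF assms(2)])
    fix x
    have "0 \<le> (2 * energy x - (w' x)\<^sup>2) * exp (2 * x)"
      using potential_nonneg[of x] by (simp add: energy_def)
    then show "\<exists>y. DERIV (\<lambda>x. energy x * exp (2 * x)) x :> y \<and> 0 \<le> y"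
      by (intro exI[of _ "(2 * energy x - (w' x)\<^sup>2) * exp (2 * x)"])
        (auto intro!: derivative_eq_intros energy_deriv simp: algebra_simps)
  qed
  then show ?thesis using assms(1)
    by (metis exp_gt_zero mult_pos_pos order_less_le_trans zero_less_mult_pos2)
qed

lemma energy_pos_of_nonzero:
  assumes "w t \<noteq> 0"
  shows "energy t > 0"
proof -
  have "0 < (exp (w t / 2) - 1)\<^sup>2" using assms by simp
  also have "\<dots> \<le> exp (w t) - 1 - w t" by (rule exp_half_minus_one_squared_le)
  finally have "0 < k * (exp (w t) - 1 - w t)" using k_pos by simp
  then show ?thesis by (simp add: energy_def add_nonneg_pos)
qed

text \<open>
  The mixed term \<open>w\<^sup>2/2 + w w'\<close> turns the dissipation \<open>w'\<^sup>2\<close> of the energy into a multiple of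
  the energy itself.
\<close>

definition lyapunov :: "real \<Rightarrow> real" where
  "lyapunov t = 2 * energy t + (w t)\<^sup>2 / 2 + w t * w' t"

text \<open>The factor 2 in \<open>lyapunov\<close> leaves one copy of w'^2/2 to complete the square
  (w + w')^2/2.\<close>

lemma lyapunov_nonneg: "0 \<le> lyapunov t"
proof -
  have "lyapunov t = energy t + k * (exp (w t) - 1 - w t) + (w t + w' t)\<^sup>2 / 2"
    by (simp add: lyapunov_def energy_def power2_eq_square algebra_simps add_divide_distrib)
  then show ?thesis using energy_nonneg[of t] potential_nonneg[of t] by simp
qed

lemma lyapunov_deriv:
  "(lyapunov has_real_derivative - (w' t)\<^sup>2 - k * (w t * (exp (w t) - 1))) (at t)"
  unfolding lyapunov_def
  by (auto intro!: derivative_eq_intros energy_deriv w_deriv w'_deriv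
      simp: power2_eq_square algebra_simps)

text \<open>The derivative of \<open>lyapunov\<close> is at most minus the energy, and the energy is
  nonincreasing, so \<open>lyapunov t + t * energy t\<close> is nonincreasing for t >= 0.\<close>

lemma energy_decay:
  assumes "0 \<le> t"
  shows "t * energy t \<le> lyapunov 0"
proof -
  have "lyapunov t + t * energy t \<le> lyapunov 0 + 0 * energy 0"
  proof (rule DERIV_nonpos_imp_nonincreasing[where f="\<lambda>x. lyapunov x + x * energy x", OF assms])
    fix x :: real assume "0 \<le> x" "x \<le> t"
    let ?y = "- (w' x)\<^sup>2 - k * (w x * (exp (w x) - 1)) + energy x - x * (w' x)\<^sup>2"
    have "k * (exp (w x) - 1 - w x) \<le> k * (w x * (exp (w x) - 1))"
      using mult_exp_diff_ge k_pos by (intro mult_left_mono) auto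
    moreover have "0 \<le> x * (w' x)\<^sup>2" using \<open>0 \<le> x\<close> by simp
    ultimately have "?y \<le> 0"
      using zero_le_power2[of "w' x"] unfolding energy_def by linarith
    moreover have "DERIV (\<lambda>x. lyapunov x + x * energy x) x :> ?y"
      by (auto intro!: derivative_eq_intros energy_deriv lyapunov_deriv)
    ultimately show "\<exists>y. DERIV (\<lambda>x. lyapunov x + x * energy x) x :> y \<and> y \<le> 0" by blast
  qed
  then show ?thesis using lyapunov_nonneg[of t] by simp
qed

lemma w_tendsto_0: "(w \<longlongrightarrow> 0) at_top"
proof -
  have "((\<lambda>t. lyapunov 0 / k * inverse t) \<longlongrightarrow> lyapunov 0 / k * 0) at_top"
    by (intro tendsto_intros tendsto_inverse_0_at_top filterlim_ident)
  then have lim: "((\<lambda>t. lyapunov 0 / k * inverse t) \<longlongrightarrow> 0) at_top" by simp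
  have bound: "(exp (w t / 2) - 1)\<^sup>2 \<le> lyapunov 0 / k * inverse t" if "t > 0" for t
  proof -
    have "k * (exp (w t / 2) - 1)\<^sup>2 \<le> k * (exp (w t) - 1 - w t)"
      using exp_half_minus_one_squared_le k_pos by (intro mult_left_mono) auto
    also have "\<dots> \<le> energy t" by (simp add: energy_def)
    finally have "t * (k * (exp (w t / 2) - 1)\<^sup>2) \<le> lyapunov 0"
      using energy_decay[of t] that by (smt (verit) mult_left_mono)
    then show ?thesis using that k_pos by (simp add: field_simps)
  qed
  have "((\<lambda>t. (exp (w t / 2) - 1)\<^sup>2) \<longlongrightarrow> 0) at_top"
    using eventually_mono[OF eventually_gt_at_top[of 0] bound]
    by (intro tendsto_sandwich[OF _ _ tendsto_const lim]) auto
  then have "((\<lambda>t. exp (w t / 2) - 1) \<longlongrightarrow> 0) at_top"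
    by (simp add: tendsto_null_power)
  from tendsto_add[OF this tendsto_const[of 1]]
  have "((\<lambda>t. exp (w t / 2)) \<longlongrightarrow> 1) at_top" by simp
  from tendsto_mult[OF tendsto_const[of 2] tendsto_ln[OF this]] show ?thesis by simp
qed

text \<open>The factor \<open>exp (t / 2)\<close> removes the first-order term of the equation.\<close>

lemma w_exp_half_deriv:
  "((\<lambda>t. w t * exp (t / 2)) has_real_derivative (w' t + w t / 2) * exp (t / 2)) (at t)"
  by (auto intro!: derivative_eq_intros w_deriv simp: algebra_simps)

lemma w_exp_half_deriv2:
  "((\<lambda>t. (w' t + w t / 2) * exp (t / 2)) has_real_derivative
     (w t / 4 - k * (exp (w t) - 1)) * exp (t / 2)) (at t)"
  by (auto intro!: derivative_eq_intros w_deriv w'_deriv simp: algebra_simps add_divide_distrib)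

text \<open>If \<sigma> w stayed nonnegative, the Sturm lemma applied to \<sigma> w exp(t/2) would
  make w vanish from some time on, against the positivity of the energy.\<close>

lemma oscillates:
  assumes "k > 1/4" and "w t0 \<noteq> 0" and \<sigma>: "\<sigma> = 1 \<or> \<sigma> = - 1"
  shows "\<exists>t>T. \<sigma> * w t < 0"
proof (rule ccontr)
  assume "\<not> ?thesis"
  then have nonneg: "\<sigma> * w t \<ge> 0" if "t > T" for t using that by force
  \<comment> \<open>Half of the gap k - 1/4; the other half absorbs the factor exp w, which is only
    close to 1.\<close>
  define d where "d = (k - 1/4) / 2"
  have "d > 0" "1/4 + d < k" using assms(1) by (auto simp: d_def field_simps)
  have "((\<lambda>t. k * exp (w t)) \<longlongrightarrow> k * exp 0) at_top"
    by (intro tendsto_intros w_tendsto_0)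
  from order_tendstoD(1)[OF this, of "1/4 + d"] \<open>1/4 + d < k\<close>
  have "eventually (\<lambda>t. 1/4 + d < k * exp (w t)) at_top" by simp
  then obtain T1 where T1: "\<And>t. t \<ge> T1 \<Longrightarrow> 1/4 + d < k * exp (w t)"
    by (auto simp: eventually_at_top_linorder)
  define S where "S = max (max T1 (T + 1)) t0"
  have "S \<ge> t0" by (simp add: S_def)
  have p''_le: "\<sigma> * (w t / 4 - k * (exp (w t) - 1)) \<le> - d * (\<sigma> * w t)" if "t \<ge> S" for t
  proof -
    have "t \<ge> T1" "t > T" using that by (auto simp: S_def)
    \<comment> \<open>For w >= 0 the tangent bound of exp suffices. For w < 0 the bound goes through
      exp w - 1 = - exp w (exp (- w) - 1) and needs k exp w > 1/4 + d.\<close>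
    show ?thesis
    proof (cases "w t \<ge> 0")
      case True
      have "(1/4 + d) * w t \<le> k * (exp (w t) - 1)"
        using True \<open>1/4 + d < k\<close> exp_minus_one_ge[of "w t"] \<open>d > 0\<close>
        by (intro mult_mono) auto
      moreover have "\<sigma> = 1 \<or> w t = 0" using True nonneg[OF \<open>t > T\<close>] \<sigma> by auto
      ultimately show ?thesis by (auto simp: algebra_simps)
    next
      case False
      have "(1/4 + d) * (- w t) \<le> (k * exp (w t)) * (exp (- w t) - 1)"
        using False T1[OF \<open>t \<ge> T1\<close>] exp_minus_one_ge[of "- w t"] \<open>d > 0\<close>
        by (intro mult_mono) auto
      also have "\<dots> = k * (1 - exp (w t))"
        by (simp add: algebra_simps exp_minus)
      finally have "(1/4 + d) * (- w t) \<le> k * (1 - exp (w t))" .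
      moreover have "\<sigma> = -1" using False nonneg[OF \<open>t > T\<close>] \<sigma> by auto
      ultimately show ?thesis by (auto simp: algebra_simps)
    qed
  qed
  have zero: "\<sigma> * (w t * exp (t / 2)) = 0" if "S \<le> t" for t
  proof (rule Sturm_nonneg_imp_zero[OF _ _ _ \<open>d > 0\<close> _ that])
    fix t assume "S \<le> t"
    show "((\<lambda>t. \<sigma> * (w t * exp (t / 2))) has_real_derivative
            \<sigma> * ((w' t + w t / 2) * exp (t / 2))) (at t)"
      by (intro DERIV_cmult w_exp_half_deriv)
    show "((\<lambda>t. \<sigma> * ((w' t + w t / 2) * exp (t / 2))) has_real_derivative
            \<sigma> * ((w t / 4 - k * (exp (w t) - 1)) * exp (t / 2))) (at t)"
      by (intro DERIV_cmult w_exp_half_deriv2)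
    have "\<sigma> * (w t / 4 - k * (exp (w t) - 1)) * exp (t / 2) \<le> - d * (\<sigma> * w t) * exp (t / 2)"
      by (intro mult_right_mono p''_le \<open>S \<le> t\<close>) auto
    then show "\<sigma> * ((w t / 4 - k * (exp (w t) - 1)) * exp (t / 2)) \<le>
        - d * (\<sigma> * (w t * exp (t / 2)))" by (simp add: algebra_simps)
    have "t > T" using \<open>S \<le> t\<close> by (auto simp: S_def)
    then have "0 \<le> (\<sigma> * w t) * exp (t / 2)" by (intro mult_nonneg_nonneg nonneg) auto
    then show "0 \<le> \<sigma> * (w t * exp (t / 2))" by (simp add: algebra_simps)
  qed
  then have w0: "w t = 0" if "S \<le> t" for t using that \<sigma> by force
  \<comment> \<open>w vanishes on a neighbourhood of S + 1, whereas at S this is known only to the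
    right.\<close>
  have "w' (S + 1) = 0"
  proof (rule DERIV_unique[OF w_deriv])
    have "(w has_real_derivative 0) (at (S + 1)) \<longleftrightarrow> ((\<lambda>_. 0) has_real_derivative 0) (at (S + 1))"
      by (intro DERIV_cong_ev refl)
        (auto intro!: eventually_mono[OF eventually_nhds_in_open[of "{S<..}" "S + 1"]] w0)
    then show "(w has_real_derivative 0) (at (S + 1))" by simp
  qed
  then have "energy (S + 1) = 0" by (simp add: energy_def w0)
  moreover have "energy (S + 1) > 0" using energy_pos[OF energy_pos_of_nonzero[OF assms(2)]] \<open>S \<ge> t0\<close> by auto
  ultimately show False by simp
qed

text \<open>While w < 0, k (1 - exp w) <= - w / 4, so p = w exp(t/2) is concave. Far to the left its
  slope is negative, since w is very negative there and w' is bounded above. Hence p decreases and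
  there is no first time at which it reaches 0.\<close>

lemma overdamped_neg:
  assumes "k \<le> 1/4" and lim: "filterlim w at_bot at_bot" and bound: "\<And>t. w' t \<le> b"
  shows "w t < 0"
proof (rule ccontr)
  assume "\<not> w t < 0"
  \<comment> \<open>\<open>Inf S\<close> will be the first time with w >= 0, so concavity is
    available all the way up to it.\<close>
  define S where "S = {x. 0 \<le> w x} \<inter> {..t}"
  \<comment> \<open>Below -2 b the slope factor w' + w / 2 is negative.\<close>
  have "eventually (\<lambda>x. w x < min 0 (- 2 * b)) at_bot"
    using lim unfolding filterlim_at_bot_dense by blast
  then obtain c where c: "\<And>x. x \<le> c \<Longrightarrow> w x < 0 \<and> w x < - 2 * b"
    by (auto simp: eventually_at_bot_linorder)
  have "closed S"
    unfolding S_def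
    by (intro closed_Int closed_Collect_le closed_atMost continuous_on_const
        DERIV_continuous_on[of _ w w'] has_field_derivative_at_within[OF w_deriv])
  moreover have "t \<in> S" using \<open>\<not> w t < 0\<close> by (simp add: S_def)
  then have "S \<noteq> {}" by blast
  moreover have bdd: "bdd_below S"
    by (rule bdd_belowI[of _ c]) (use c in \<open>force simp: S_def not_less[symmetric]\<close>)
  ultimately have InfS: "Inf S \<in> S" by (rule closed_contains_Inf[rotated 2])
  have neg: "w x < 0" if "x < Inf S" for x
  proof (rule ccontr)
    assume "\<not> w x < 0"
    then have "x \<in> S" using that InfS by (auto simp: S_def)
    then show False using cInf_lower[OF _ bdd, of x] that by auto
  qed
  have "c < Inf S" using c[of "Inf S"] InfS by (force simp: S_def)
  have p'_neg: "(w' x + w x / 2) * exp (x / 2) < 0" if "c \<le> x" "x < Inf S" for x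
  proof -
    have "(w' x + w x / 2) * exp (x / 2) \<le> (w' c + w c / 2) * exp (c / 2)"
    proof (rule DERIV_nonpos_imp_nonincreasing
        [where f="\<lambda>t. (w' t + w t / 2) * exp (t / 2)", OF \<open>c \<le> x\<close>])
      fix y assume "c \<le> y" "y \<le> x"
      then have "w y < 0" using neg that by auto
      have "k * (1 - exp (w y)) \<le> 1/4 * (- w y)"
        using assms(1) k_pos exp_minus_one_ge[of "w y"] \<open>w y < 0\<close> by (intro mult_mono) auto
      then have "(w y / 4 - k * (exp (w y) - 1)) * exp (y / 2) \<le> 0"
        by (intro mult_nonpos_nonneg) (auto simp: algebra_simps)
      then show "\<exists>z. DERIV (\<lambda>t. (w' t + w t / 2) * exp (t / 2)) y :> z \<and> z \<le> 0"
        using w_exp_half_deriv2 by blast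
    qed
    also have "\<dots> < 0" using c[of c] bound[of c] by (intro mult_neg_pos) auto
    finally show ?thesis .
  qed
  have "w (Inf S) * exp (Inf S / 2) < w c * exp (c / 2)"
  proof (rule DERIV_neg_imp_decreasing_open[where f="\<lambda>t. w t * exp (t / 2)", OF \<open>c < Inf S\<close>])
    show "\<exists>y. DERIV (\<lambda>t. w t * exp (t / 2)) x :> y \<and> y < 0" if "c < x" "x < Inf S" for x
      using w_exp_half_deriv p'_neg[of x] that by fastforce
    show "continuous_on {c..Inf S} (\<lambda>t. w t * exp (t / 2))"
      by (rule DERIV_continuous_on[OF has_field_derivative_at_within[OF w_exp_half_deriv]])
  qed
  also have "\<dots> < 0" using c[of c] by (intro mult_neg_pos) auto
  finally have "w (Inf S) < 0" by (simp add: mult_less_0_iff)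
  then show False using InfS by (auto simp: S_def)
qed

text \<open>The integrating factor exp t removes the damping: w' exp t has derivative - k (exp w -
  1) exp t, positive because w < 0, and it starts from the limit 0.\<close>

lemma overdamped_increasing:
  assumes "k \<le> 1/4" and "filterlim w at_bot at_bot" and "\<And>t. w' t \<le> b"
    and lim: "((\<lambda>t. w' t * exp t) \<longlongrightarrow> 0) at_bot"
  shows "w' t > 0"
proof -
  have deriv: "((\<lambda>t. w' t * exp t) has_real_derivative - k * (exp (w t) - 1) * exp t) (at t)" for t
    by (auto intro!: derivative_eq_intros w'_deriv simp: algebra_simps)
  have incr: "w' x * exp x < w' y * exp y" if "x < y" for x y
  proof (rule DERIV_pos_imp_increasing[where f="\<lambda>t. w' t * exp t", OF that])
    fix z
    have "0 < - k * (exp (w z) - 1) * exp z"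
      using overdamped_neg[OF assms(1-3), of z] k_pos by (simp add: mult_less_0_iff)
    then show "\<exists>y. DERIV (\<lambda>t. w' t * exp t) z :> y \<and> y > 0" using deriv by blast
  qed
  have "\<forall>\<^sub>F x in at_bot. w' x * exp x \<le> w' (t - 1) * exp (t - 1)"
    by (rule eventually_mono[OF eventually_le_at_bot[of "t - 2"]]) (simp add: incr less_imp_le)
  then have "0 \<le> w' (t - 1) * exp (t - 1)"
    by (rule tendsto_upperbound[OF lim]) simp
  also have "\<dots> < w' t * exp t" by (rule incr) simp
  finally show ?thesis by (simp add: zero_less_mult_iff)
qed

end

section \<open>The equation on the half-line\<close>

text \<open>
  The equation of \<open>(P)\<close> in the variable \<open>s = 1 - ln r\<close> for the unknown \<open>z = u + ln \<lambda>\<close>; the origin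
  \<open>r = 0\<close> becomes \<open>s = \<infinity>\<close>.
\<close>

definition solves_on :: "real \<Rightarrow> real \<Rightarrow> (real \<Rightarrow> real) \<Rightarrow> (real \<Rightarrow> real) \<Rightarrow> bool" where
  "solves_on k a z z' \<longleftrightarrow> (\<forall>s>a. (z has_real_derivative z' s) (at s) \<and>
     (z' has_real_derivative - (s powr (- 2 - k) * exp (z s))) (at s))"

lemma solves_onD:
  assumes "solves_on k a z z'" "a < s"
  shows "(z has_real_derivative z' s) (at s)"
    and "(z' has_real_derivative - (s powr (- 2 - k) * exp (z s))) (at s)"
  using assms by (auto simp: solves_on_def)

section \<open>Profiles with a finite limit at infinity\<close>

lemma solves_on_deriv:
  assumes "solves_on k a z z'" "0 \<le> a" "(z \<longlongrightarrow> b) at_top"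
  shows "\<And>s. a < s \<Longrightarrow> 0 < z' s" "(z' \<longlongrightarrow> 0) at_top"
proof -
  have "- (s powr (- 2 - k) * exp (z s)) < 0" if "a < s" for s using that assms(2) by simp
  note * = concave_tendsto[OF solves_onD[OF assms(1)] this assms(3)]
  show "\<And>s. a < s \<Longrightarrow> 0 < z' s" by (rule *(1))
  show "(z' \<longlongrightarrow> 0) at_top" by (rule *(2))
qed

lemma solves_on_strict_mono:
  assumes "solves_on k a z z'" "0 \<le> a" "(z \<longlongrightarrow> b) at_top" "a < x" "x < y"
  shows "z x < z y"
  using assms by (intro DERIV_pos_imp_increasing[of x y z])
    (metis solves_on_deriv(1) solves_onD(1) order_less_le_trans)+

lemma solves_on_less:
  assumes "solves_on k a z z'" "0 \<le> a" "(z \<longlongrightarrow> b) at_top" "a < s"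
  shows "z s < b"
proof -
  have "\<forall>\<^sub>F x in at_top. z (s + 1) \<le> z x"
    using solves_on_strict_mono[OF assms(1-3)] \<open>a < s\<close>
    by (intro eventually_mono[OF eventually_gt_at_top[of "s + 1"]]) (simp add: less_imp_le)
  then have "z (s + 1) \<le> b" by (intro tendsto_lowerbound[OF assms(3)]) auto
  then show ?thesis using solves_on_strict_mono[OF assms(1-4), of "s + 1"] by simp
qed

text \<open>
  The weight \<open>W s = exp (M s\<^sup>-\<^sup>k)\<close> makes the integrated equation a contraction on the whole
  half-line at once.
\<close>

lemma solves_on_unique:
  fixes k :: real
  assumes "k > 0" "0 \<le> a"
    and z1: "solves_on k a z1 z1'" "(z1 \<longlongrightarrow> b) at_top"
    and z2: "solves_on k a z2 z2'" "(z2 \<longlongrightarrow> b) at_top"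
    and "a < s"
  shows "z1 s = z2 s"
proof -
  \<comment> \<open>The supremum below is taken over s > c because solutions may be unbounded near
    a.\<close>
  define c where "c = (a + s) / 2"
  have c: "a < c" "c < s" "0 < c" using \<open>a < s\<close> \<open>0 \<le> a\<close> by (auto simp: c_def)
  \<comment> \<open>exp b is the Lipschitz constant of exp below b; the two integrations contribute
    1 / (1 + k) and 1 / (M k), so the contraction factor is exactly 1/2.\<close>
  define M where "M = 2 * exp b / (k * (1 + k))"
  have "M > 0" using \<open>k > 0\<close> by (simp add: M_def)
  define W where "W t = exp (M * t powr (- k))" for t
  have W_ge1: "1 \<le> W t" for t using \<open>M > 0\<close> by (simp add: W_def)
  have W_deriv: "(W has_real_derivative - (M * k * (t powr (- 1 - k) * W t))) (at t)"
    if "0 < t" for t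
    unfolding W_def using that
    by (auto intro!: derivative_eq_intros simp: powr_diff powr_minus field_simps)
  define D where "D t = z1 t - z2 t" for t
  define S where "S = (\<lambda>t. \<bar>D t\<bar> / W t) ` {c<..}"
  define m where "m = Sup S"
  have "bdd_above S"
  proof -
    define B where "B = \<bar>b - z1 c\<bar> + \<bar>b - z2 c\<bar>"
    have "\<bar>D t\<bar> / W t \<le> B" if "c < t" for t
    proof -
      have "\<bar>D t\<bar> \<le> B"
        using solves_on_strict_mono[OF z1(1) \<open>0 \<le> a\<close> z1(2) c(1) that]
          solves_on_strict_mono[OF z2(1) \<open>0 \<le> a\<close> z2(2) c(1) that]
          solves_on_less[OF z1(1) \<open>0 \<le> a\<close> z1(2), of t]
          solves_on_less[OF z2(1) \<open>0 \<le> a\<close> z2(2), of t] c that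
        by (auto simp: D_def B_def)
      then have "\<bar>D t\<bar> \<le> B * W t"
        using W_ge1[of t] by (smt (verit) mult_left_mono mult_cancel_left1)
      then show ?thesis using W_ge1[of t] by (simp add: divide_le_eq)
    qed
    then show ?thesis by (auto simp: S_def bdd_above_def)
  qed
  have D_le: "\<bar>D t\<bar> \<le> m * W t" if "c < t" for t
  proof -
    have "\<bar>D t\<bar> / W t \<le> m"
      unfolding m_def by (rule cSup_upper[OF _ \<open>bdd_above S\<close>]) (use that in \<open>simp add: S_def\<close>)
    then show ?thesis using W_ge1[of t] by (simp add: divide_le_eq)
  qed
  have "0 \<le> m" using D_le[OF c(2)] W_ge1[of s] by (smt (verit) mult_neg_pos)
  define C where "C = exp b * m / (1 + k)"
  have "0 \<le> C" using \<open>0 \<le> m\<close> \<open>k > 0\<close> by (simp add: C_def)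
  define D' where "D' t = z1' t - z2' t" for t
  define D'' where "D'' t = t powr (- 2 - k) * (exp (z2 t) - exp (z1 t))" for t
  have D'_le: "\<bar>D' t\<bar> \<le> C * (t powr (- 1 - k) * W t)" if "c < t" for t
  proof (rule abs_le_of_abs_deriv_le[OF _ _ _ _ _ that])
    fix t assume "c < t"
    then have t: "a < t" "0 < t" using c by auto
    show "(D' has_real_derivative D'' t) (at t)"
      unfolding D'_def D''_def using solves_onD(2)[OF z1(1) t(1)] solves_onD(2)[OF z2(1) t(1)]
      by (auto intro!: derivative_eq_intros simp: algebra_simps)
    have powr_deriv: "((\<lambda>t. t powr (- 1 - k)) has_real_derivative - ((1 + k) * t powr (- 2 - k))) (at t)"
      
    proof (rule DERIV_cong[OF has_real_derivative_powr[OF t(2)]])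
      have "- 1 - k - 1 = - 2 - k" by simp
      then show "(- 1 - k) * t powr (- 1 - k - 1) = - ((1 + k) * t powr (- 2 - k))"
        by (simp only: minus_mult_left) simp
    qed
    show "((\<lambda>t. C * (t powr (- 1 - k) * W t)) has_real_derivative
        - (C * ((1 + k) * (t powr (- 2 - k) * W t) +
           t powr (- 1 - k) * (M * k * (t powr (- 1 - k) * W t))))) (at t)"
      by (rule DERIV_cong[OF DERIV_cmult[OF DERIV_mult[OF powr_deriv W_deriv[OF t(2)]]]])
        (simp add: algebra_simps)
    have "\<bar>D'' t\<bar> = t powr (- 2 - k) * \<bar>exp (z1 t) - exp (z2 t)\<bar>"
      by (simp add: D''_def abs_mult abs_minus_commute)
    also have "\<dots> \<le> t powr (- 2 - k) * (exp b * (m * W t))"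
    proof (rule mult_left_mono)
      have "\<bar>exp (z1 t) - exp (z2 t)\<bar> \<le> exp b * \<bar>D t\<bar>"
        unfolding D_def
        using solves_on_less[OF z1(1) \<open>0 \<le> a\<close> z1(2) t(1)] solves_on_less[OF z2(1) \<open>0 \<le> a\<close> z2(2) t(1)]
        by (intro exp_diff_le) auto
      also have "\<dots> \<le> exp b * (m * W t)" by (intro mult_left_mono D_le \<open>c < t\<close>) auto
      finally show "\<bar>exp (z1 t) - exp (z2 t)\<bar> \<le> exp b * (m * W t)" .
    qed simp
    also have "\<dots> = C * ((1 + k) * (t powr (- 2 - k) * W t))"
      using \<open>k > 0\<close> by (simp add: C_def)
    \<comment> \<open>The added term completes the exact derivative of
      \<open>t powr (- 1 - k) * W t\<close>, up to sign and the factor C.\<close>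
    also have "\<dots> \<le> C * ((1 + k) * (t powr (- 2 - k) * W t) +
           t powr (- 1 - k) * (M * k * (t powr (- 1 - k) * W t)))"
      using \<open>0 \<le> C\<close> \<open>k > 0\<close> \<open>M > 0\<close> W_ge1[of t] by (intro mult_left_mono) auto
    finally show "\<bar>D'' t\<bar> \<le> - (- (C * ((1 + k) * (t powr (- 2 - k) * W t) +
           t powr (- 1 - k) * (M * k * (t powr (- 1 - k) * W t)))))" by simp
    show "0 \<le> C * (t powr (- 1 - k) * W t)" using \<open>0 \<le> C\<close> W_ge1[of t] by simp
  next
    show "(D' \<longlongrightarrow> 0) at_top"
      unfolding D'_def using tendsto_diff[OF solves_on_deriv(2)[OF z1(1) \<open>0 \<le> a\<close> z1(2)]
          solves_on_deriv(2)[OF z2(1) \<open>0 \<le> a\<close> z2(2)]] by simp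
  qed
  have half: "\<bar>D t\<bar> \<le> C / (M * k) * W t" if "c < t" for t
  proof (rule abs_le_of_abs_deriv_le[OF _ _ _ _ _ that])
    fix t assume "c < t"
    then have t: "a < t" "0 < t" using c by auto
    show "(D has_real_derivative D' t) (at t)"
      unfolding D'_def D_def using solves_onD(1)[OF z1(1) t(1)] solves_onD(1)[OF z2(1) t(1)]
      by (intro DERIV_diff)
    show "((\<lambda>t. C / (M * k) * W t) has_real_derivative - (C * (t powr (- 1 - k) * W t))) (at t)"
      using DERIV_cmult[OF W_deriv[OF t(2)], of "C / (M * k)"] \<open>k > 0\<close> \<open>M > 0\<close> by simp
    show "\<bar>D' t\<bar> \<le> - (- (C * (t powr (- 1 - k) * W t)))" using D'_le \<open>c < t\<close> by simp
    show "0 \<le> C / (M * k) * W t" using \<open>0 \<le> C\<close> \<open>k > 0\<close> \<open>M > 0\<close> W_ge1[of t] by simp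
  next
    show "(D \<longlongrightarrow> 0) at_top" unfolding D_def using tendsto_diff[OF z1(2) z2(2)] by simp
  qed
  have "C / (M * k) = m / 2" using \<open>k > 0\<close> by (simp add: C_def M_def)
  then have "\<bar>D t\<bar> \<le> m / 2 * W t" if "c < t" for t using half[OF that] by (simp only:)
  then have "\<bar>D t\<bar> / W t \<le> m / 2" if "c < t" for t
    using W_ge1[of t] that by (simp add: pos_divide_le_eq)
  moreover have "S \<noteq> {}" using c by (auto simp: S_def)
  ultimately have "m \<le> m / 2" unfolding m_def by (intro cSup_least) (auto simp: S_def m_def)
  then have "m = 0" using \<open>0 \<le> m\<close> by simp
  then show ?thesis using D_le[OF c(2)] by (simp add: D_def)
qed

section \<open>Existence of a profile as a Picard fixed point\<close>

lemma has_real_derivative_integral: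
  fixes g :: "real \<Rightarrow> real"
  assumes "continuous_on {a..} g" "a < x"
  shows "((\<lambda>x. integral {a..x} g) has_real_derivative g x) (at x)"
proof -
  have "continuous_on {a..x + 1} g" by (rule continuous_on_subset[OF assms(1)]) auto
  then have "((\<lambda>x. integral {a..x} g) has_real_derivative g x) (at x within {a..x + 1})"
    by (rule integral_has_real_derivative) (use assms(2) in auto)
  then show ?thesis using assms(2) at_within_interior[of x "{a..x + 1}"] by simp
qed

text \<open>
  The truncation \<open>min 0\<close> makes the exponential bounded and Lipschitz; a fixed point is nonpositive
  on \<open>x \<ge> 0\<close>, so there the truncation has no effect.
\<close>

definition picard :: "real \<Rightarrow> (real \<Rightarrow> real) \<Rightarrow> real \<Rightarrow> real" where
  "picard k G x = - (x / k) * integral {0..1} (\<lambda>r. (1 - r powr (1 / k)) * exp (min 0 (G (x * r))))"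

text \<open>Over the fixed interval from 0 to 1, x is a mere parameter. Joint continuity makes
  \<open>picard k G\<close> continuous on the whole line, as the fixed point argument in bounded
  continuous functions requires.\<close>

lemma continuous_on_picard_integrand:
  fixes G :: "real \<Rightarrow> real" and k :: real
  assumes "k > 0" "continuous_on UNIV G"
  shows "continuous_on (UNIV \<times> cbox 0 1)
    (\<lambda>(x, r). (1 - r powr (1 / k)) * exp (min 0 (G (x * r))))"
proof -
  have "continuous_on (UNIV \<times> cbox 0 (1::real)) (\<lambda>p. snd p powr (1 / k))"
    using assms(1) by (intro continuous_on_powr') (auto intro!: continuous_intros)
  moreover have "continuous_on (UNIV \<times> cbox 0 (1::real)) (\<lambda>p. G (fst p * snd p))"
    by (rule continuous_on_compose2[OF assms(2)]) (auto intro!: continuous_intros)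
  ultimately show ?thesis
    unfolding case_prod_unfold
    by (intro continuous_on_mult continuous_on_diff continuous_on_const continuous_on_exp
        continuous_on_min)
qed

lemma picard_integrable:
  fixes G :: "real \<Rightarrow> real"
  assumes "k > 0" "continuous_on UNIV G"
  shows "(\<lambda>r. (1 - r powr (1 / k)) * exp (min 0 (G (x * r)))) integrable_on {0..1}"
proof (rule integrable_continuous_real)
  have "continuous_on {0..1} (\<lambda>r. (\<lambda>(x, r). (1 - r powr (1 / k)) * exp (min 0 (G (x * r)))) (x, r))"
    by (rule continuous_on_compose2[OF continuous_on_picard_integrand[OF assms]])
      (auto intro!: continuous_intros)
  then show "continuous_on {0..1} (\<lambda>r. (1 - r powr (1 / k)) * exp (min 0 (G (x * r))))" by simp
qed

lemma continuous_on_picard: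
  fixes G :: "real \<Rightarrow> real"
  assumes "k > 0" "continuous_on UNIV G"
  shows "continuous_on UNIV (picard k G)"
  unfolding picard_def
  using integral_continuous_on_param[OF continuous_on_picard_integrand[OF assms]] assms(1)
  by (intro continuous_intros) auto

lemma abs_one_minus_powr_le:
  fixes r k :: real
  assumes "r \<in> {0..1}" "k > 0"
  shows "\<bar>1 - r powr (1 / k)\<bar> \<le> 1"
proof -
  have "r powr (1 / k) \<le> 1" using assms by (intro powr_le1) auto
  then show ?thesis using powr_ge_zero[of r "1 / k"] by (auto simp: abs_le_iff)
qed

lemma abs_picard_le:
  fixes G :: "real \<Rightarrow> real"
  assumes "k > 0" "continuous_on UNIV G"
  shows "\<bar>picard k G x\<bar> \<le> \<bar>x\<bar> / k"
proof -
  have "norm (integral {0..1} (\<lambda>r. (1 - r powr (1 / k)) * exp (min 0 (G (x * r)))))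
    \<le> integral {0..1} (\<lambda>r::real. 1)"
  proof (rule integral_norm_bound_integral[OF picard_integrable[OF assms]])
    fix r :: real assume "r \<in> {0..1}"
    then have "\<bar>1 - r powr (1 / k)\<bar> * exp (min 0 (G (x * r))) \<le> 1 * 1"
      using abs_one_minus_powr_le[OF _ assms(1)] by (intro mult_mono) auto
    then show "norm ((1 - r powr (1 / k)) * exp (min 0 (G (x * r)))) \<le> 1"
      by (simp add: abs_mult)
  qed auto
  then show ?thesis
    using assms(1) mult_left_mono[of _ 1 "\<bar>x\<bar> / k"] by (simp add: picard_def abs_mult)
qed

text \<open>Integrating the weight exp (M |x| r) over r gains 1 / (M |x|), which cancels the |x| in
  front of the integral and leaves 1 / (k M).\<close>

lemma picard_contraction:
  fixes G H :: "real \<Rightarrow> real"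
  assumes "k > 0" "continuous_on UNIV G" "continuous_on UNIV H" "M > 0"
    and le: "\<And>y. \<bar>G y - H y\<bar> \<le> exp (M * \<bar>y\<bar>) * d"
  shows "\<bar>picard k G x - picard k H x\<bar> \<le> exp (M * \<bar>x\<bar>) * d / (k * M)"
proof (cases "x = 0")
  case True
  have "0 \<le> d" using le[of 0] by simp
  then show ?thesis using True assms(1,4) by (simp add: picard_def)
next
  case False
  have "0 \<le> d" using le[of 0] by simp
  let ?g = "\<lambda>G r. (1 - r powr (1 / k)) * exp (min 0 (G (x * r)))"
  have "((\<lambda>r. exp (M * \<bar>x\<bar> * r) * d) has_integral
      (exp (M * \<bar>x\<bar> * 1) * d / (M * \<bar>x\<bar>) - exp (M * \<bar>x\<bar> * 0) * d / (M * \<bar>x\<bar>))) {0..1}"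
    using False assms(4)
    by (intro fundamental_theorem_of_calculus)
      (auto intro!: derivative_eq_intros simp: has_real_derivative_iff_has_vector_derivative[symmetric])
  then have int: "((\<lambda>r. exp (M * \<bar>x\<bar> * r) * d) has_integral (exp (M * \<bar>x\<bar>) - 1) * d / (M * \<bar>x\<bar>)) {0..1}"
    by (simp add: left_diff_distrib diff_divide_distrib)
  have "norm (integral {0..1} (\<lambda>r. ?g G r - ?g H r)) \<le> integral {0..1} (\<lambda>r. exp (M * \<bar>x\<bar> * r) * d)"
  proof (rule integral_norm_bound_integral)
    fix r :: real assume r: "r \<in> {0..1}"
    have "norm (?g G r - ?g H r) = \<bar>1 - r powr (1 / k)\<bar> * \<bar>exp (min 0 (G (x * r))) - exp (min 0 (H (x * r)))\<bar>"
      by (simp add: right_diff_distrib flip: abs_mult)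
    also have "\<dots> \<le> 1 * (exp 0 * \<bar>min 0 (G (x * r)) - min 0 (H (x * r))\<bar>)"
      using r assms(1) by (intro mult_mono abs_one_minus_powr_le exp_diff_le) auto
    also have "\<dots> \<le> \<bar>G (x * r) - H (x * r)\<bar>" by simp
    also have "\<dots> \<le> exp (M * \<bar>x * r\<bar>) * d" by (rule le)
    also have "\<dots> = exp (M * \<bar>x\<bar> * r) * d" using r by (simp add: abs_mult mult.assoc)
    finally show "norm (?g G r - ?g H r) \<le> exp (M * \<bar>x\<bar> * r) * d" .
  qed (use int in \<open>auto intro!: integrable_diff picard_integrable assms\<close>)
  also have "\<dots> = (exp (M * \<bar>x\<bar>) - 1) * d / (M * \<bar>x\<bar>)" using int by (rule integral_unique)
  finally have "\<bar>integral {0..1} (\<lambda>r. ?g G r - ?g H r)\<bar> \<le> (exp (M * \<bar>x\<bar>) - 1) * d / (M * \<bar>x\<bar>)"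
    by simp
  then have "\<bar>x\<bar> / k * \<bar>integral {0..1} (\<lambda>r. ?g G r - ?g H r)\<bar>
      \<le> \<bar>x\<bar> / k * ((exp (M * \<bar>x\<bar>) - 1) * d / (M * \<bar>x\<bar>))"
    using assms(1) by (intro mult_left_mono) auto
  also have "\<dots> = (exp (M * \<bar>x\<bar>) - 1) * d / (k * M)" using False assms by simp
  also have "\<dots> \<le> exp (M * \<bar>x\<bar>) * d / (k * M)"
    using \<open>0 \<le> d\<close> assms by (intro divide_right_mono mult_right_mono) auto
  finally have "\<bar>x\<bar> / k * \<bar>integral {0..1} (\<lambda>r. ?g G r - ?g H r)\<bar> \<le> exp (M * \<bar>x\<bar>) * d / (k * M)" .
  moreover have "picard k G x - picard k H x = - (x / k) * integral {0..1} (\<lambda>r. ?g G r - ?g H r)"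
    unfolding picard_def using assms
    by (subst integral_diff) (auto intro!: picard_integrable simp: right_diff_distrib)
  ultimately show ?thesis using assms(1) by (simp add: abs_mult)
qed

text \<open>Bounded continuous functions are multiplied by \<open>exp (2 \<bar>x\<bar> / k)\<close> to contract by \<open>1/2\<close>.\<close>

lemma picard_fixpoint:
  assumes "k > 0"
  obtains G where "continuous_on UNIV G" "\<And>x. G x = picard k G x"
proof -
  define M where "M = 2 / k"
  have "M > 0" using assms by (simp add: M_def)
  define lift :: "(real \<Rightarrow>\<^sub>C real) \<Rightarrow> real \<Rightarrow> real" where "lift g x = exp (M * \<bar>x\<bar>) * g x" for g x
  have cont: "continuous_on UNIV (lift g)" for g
    unfolding lift_def by (intro continuous_intros) auto
  define S where "S g = Bcontfun (\<lambda>x. exp (- (M * \<bar>x\<bar>)) * picard k (lift g) x)" for g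
  have "(\<lambda>x. exp (- (M * \<bar>x\<bar>)) * picard k (lift g) x) \<in> bcontfun" for g
  proof (rule bcontfun_normI)
    show "continuous_on UNIV (\<lambda>x. exp (- (M * \<bar>x\<bar>)) * picard k (lift g) x)"
      by (intro continuous_intros continuous_on_picard assms cont)
    fix x
    have "exp (- (M * \<bar>x\<bar>)) * \<bar>picard k (lift g) x\<bar> \<le> exp (- (M * \<bar>x\<bar>)) * (\<bar>x\<bar> / k)"
      by (intro mult_left_mono abs_picard_le assms cont) auto
    also have "\<dots> \<le> exp (- (M * \<bar>x\<bar>)) * exp (M * \<bar>x\<bar>)"
    proof (rule mult_left_mono)
      have "\<bar>x\<bar> / k \<le> M * \<bar>x\<bar>" using assms by (simp add: M_def divide_right_mono)
      also have "\<dots> \<le> exp (M * \<bar>x\<bar>)" using exp_minus_one_ge[of "M * \<bar>x\<bar>"] by simp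
      finally show "\<bar>x\<bar> / k \<le> exp (M * \<bar>x\<bar>)" .
    qed simp
    finally show "norm (exp (- (M * \<bar>x\<bar>)) * picard k (lift g) x) \<le> 1"
      by (simp add: abs_mult flip: exp_add)
  qed
  then have S: "S g x = exp (- (M * \<bar>x\<bar>)) * picard k (lift g) x" for g x
    unfolding S_def by (simp add: Bcontfun_inverse)
  have "dist (S g) (S h) \<le> 1/2 * dist g h" for g h
  proof (rule dist_bound)
    fix x
    have "\<bar>lift g y - lift h y\<bar> \<le> exp (M * \<bar>y\<bar>) * dist g h" for y
      using dist_bounded[of g y h] by (simp add: lift_def dist_real_def abs_mult flip: right_diff_distrib)
    from picard_contraction[OF assms cont cont \<open>M > 0\<close> this, of x]
    have "exp (- (M * \<bar>x\<bar>)) * \<bar>picard k (lift g) x - picard k (lift h) x\<bar>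
      \<le> exp (- (M * \<bar>x\<bar>)) * (exp (M * \<bar>x\<bar>) * dist g h / (k * M))"
      by (intro mult_left_mono) auto
    also have "\<dots> = 1/2 * dist g h" using assms by (simp add: M_def exp_minus)
    finally show "dist (S g x) (S h x) \<le> 1/2 * dist g h"
      by (simp add: S dist_real_def abs_mult flip: right_diff_distrib)
  qed
  then have "\<exists>!g. S g = g" by (intro banach_fix_type[of "1/2"]) auto
  then obtain g where "S g = g" by blast
  then have "g x = exp (- (M * \<bar>x\<bar>)) * picard k (lift g) x" for x using S[of g x] by simp
  then have "lift g x = picard k (lift g) x" for x
    by (simp add: lift_def[of g x] exp_minus)
  then show thesis using that cont by blast
qed

text \<open>
  In the variable \<open>x = s\<^sup>-\<^sup>k\<close> the point \<open>s = \<infinity>\<close> becomes \<open>x = 0\<close>, where the integrated equation is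
  regular.
\<close>

lemma solution_exists:
  assumes "k > 0"
  obtains z z' where "solves_on k 0 z z'" "(z \<longlongrightarrow> 0) at_top"
proof -
  obtain G where cont: "continuous_on UNIV G" and G: "\<And>x. G x = picard k G x"
    using picard_fixpoint[OF assms] by blast
  have G_le: "G x \<le> 0" if "0 \<le> x" for x
  proof -
    have "0 \<le> integral {0..1} (\<lambda>r. (1 - r powr (1 / k)) * exp (min 0 (G (x * r))))"
      using assms
      by (intro integral_nonneg picard_integrable cont mult_nonneg_nonneg) (auto intro!: powr_le1)
    then show ?thesis using that assms by (subst G) (simp add: picard_def)
  qed
  define g where "g y = y powr (1 / k) * exp (G y)" for y
  have cont_exp: "continuous_on {0..} (\<lambda>y. exp (G y))"
    by (intro continuous_intros continuous_on_subset[OF cont]) auto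
  have cont_g: "continuous_on {0..} g"
    unfolding g_def using assms by (intro continuous_on_mult cont_exp continuous_on_powr') (auto intro!: continuous_intros)
  define I where "I x = integral {0..x} (\<lambda>y. exp (G y))" for x
  define J where "J x = integral {0..x} g" for x
  have I: "(I has_real_derivative exp (G x)) (at x)" if "0 < x" for x
    unfolding I_def by (rule has_real_derivative_integral[OF cont_exp that])
  have J: "(J has_real_derivative g x) (at x)" if "0 < x" for x
    unfolding J_def by (rule has_real_derivative_integral[OF cont_g that])
  \<comment> \<open>The kernel depends on x; splitting it leaves antiderivatives \<open>I\<close>
    and \<open>J\<close> of fixed functions, to which the fundamental theorem applies.\<close>
  have G_eq: "G x = - (1 / k) * (I x - x powr - (1 / k) * J x)" if "0 < x" for x
  proof -
    have sub: "{0..x} \<subseteq> {0..}" by auto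
    have "((\<lambda>y. exp (G y) - x powr - (1 / k) * g y) has_integral (I x - x powr - (1 / k) * J x)) {0..x}"
      unfolding I_def J_def
      by (intro has_integral_diff has_integral_mult_right integrable_integral integrable_continuous_real
          continuous_on_subset[OF cont_exp sub] continuous_on_subset[OF cont_g sub])
    from has_integral_stretch_real[OF this, of x] that
    have "((\<lambda>r. exp (G (x * r)) - x powr - (1 / k) * g (x * r)) has_integral
        (1 / x) * (I x - x powr - (1 / k) * J x)) {0..1}"
      by simp
    moreover have "exp (G (x * r)) - x powr - (1 / k) * g (x * r)
        = (1 - r powr (1 / k)) * exp (min 0 (G (x * r)))" if "r \<in> {0..1}" for r
      using that G_le[of "x * r"] \<open>0 < x\<close>
      by (simp add: g_def powr_mult powr_minus min_absorb2 algebra_simps)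
    ultimately have "((\<lambda>r. (1 - r powr (1 / k)) * exp (min 0 (G (x * r)))) has_integral
        (1 / x) * (I x - x powr - (1 / k) * J x)) {0..1}"
      by (rule has_integral_eq[rotated])
    then show ?thesis
      using that by (subst G) (simp add: picard_def integral_unique)
  qed
  define z where "z s = G (s powr - k)" for s
  define z' where "z' s = J (s powr - k) / k" for s
  have powr_inv: "(s powr - k) powr (1 / k) = 1 / s" "(s powr - k) powr - (1 / k) = s" if "0 < s" for s
  proof -
    show "(s powr - k) powr (1 / k) = 1 / s"
      unfolding powr_powr using that assms by (simp add: powr_minus_divide)
    show "(s powr - k) powr - (1 / k) = s"
      unfolding powr_powr using that assms by simp
  qed
  have powr_deriv: "((\<lambda>s. s powr - k) has_real_derivative - (k * s powr (- 1 - k))) (at s)" if "0 < s" for s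
  proof (rule DERIV_cong[OF has_real_derivative_powr[OF that]])
    have "- k - 1 = - 1 - k" by simp
    then show "- k * s powr (- k - 1) = - (k * s powr (- 1 - k))" by (simp only: minus_mult_left)
  qed
  have "(z has_real_derivative z' s) (at s)" if "0 < s" for s
  proof -
    \<comment> \<open>The contributions of the derivatives of \<open>I\<close> and \<open>J\<close>
      cancel, as \<open>s * g (s powr - k) = exp (z s)\<close>; only \<open>J / k\<close> from the
      explicit factor s survives.\<close>
    have "((\<lambda>s. - (1 / k) * (I (s powr - k) - s * J (s powr - k))) has_real_derivative z' s) (at s)"
      using that assms
      by (auto intro!: derivative_eq_intros DERIV_chain2[OF I] DERIV_chain2[OF J] powr_deriv
          simp: z'_def g_def powr_inv field_simps)
    moreover have "\<forall>\<^sub>F t in nhds s. z t = - (1 / k) * (I (t powr - k) - t * J (t powr - k))"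
      using eventually_nhds_in_open[of "{0<..}" s] that
      by (auto elim!: eventually_mono simp: z_def G_eq powr_inv)
    ultimately show ?thesis by (subst DERIV_cong_ev[OF refl _ refl])
  qed
  moreover have "(z' has_real_derivative - (s powr (- 2 - k) * exp (z s))) (at s)" if "0 < s" for s
  proof -
    have "(z' has_real_derivative g (s powr - k) * (- (k * s powr (- 1 - k))) / k) (at s)"
      unfolding z'_def using that by (intro DERIV_cdivide DERIV_chain2[OF J] powr_deriv) auto
    moreover have "g (s powr - k) * (- (k * s powr (- 1 - k))) / k = - (s powr (- 2 - k) * exp (z s))"
      using that assms by (simp add: g_def z_def powr_inv powr_diff powr_neg_one powr_neg_numeral power2_eq_square field_simps)
    ultimately show ?thesis by simp
  qed
  ultimately have "solves_on k 0 z z'" by (simp add: solves_on_def)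
  moreover have "(z \<longlongrightarrow> 0) at_top"
  proof -
    have "isCont G 0" using cont by (simp add: continuous_on_eq_continuous_at)
    moreover have "((\<lambda>s. s powr - k) \<longlongrightarrow> 0) at_top"
      using assms by (intro tendsto_neg_powr filterlim_ident) auto
    ultimately have "(z \<longlongrightarrow> G 0) at_top" unfolding z_def by (rule isCont_tendsto_compose)
    moreover have "G 0 = 0" by (subst G) (simp add: picard_def)
    ultimately show ?thesis by simp
  qed
  ultimately show thesis by (rule that)
qed

section \<open>Radial solutions\<close>

text \<open>Along a coordinate line the norm N(t) of x + t b has derivative (x \<bullet> b + t) /
  N(t). The second derivatives then add up because the squares of x \<bullet> b sum to the squared
  norm.\<close>

lemma laplacian_radial:
  fixes x :: "'a::euclidean_space"
  assumes \<phi>: "\<And>r. 0 < r \<Longrightarrow> r < R \<Longrightarrow> (\<phi> has_real_derivative \<phi>' r) (at r)"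
    and \<phi>': "\<And>r. 0 < r \<Longrightarrow> r < R \<Longrightarrow> (\<phi>' has_real_derivative \<phi>'' r) (at r)"
    and u: "\<And>y. norm y < R \<Longrightarrow> u y = \<phi> (norm y)"
    and x: "x \<noteq> 0" "norm x < R"
  shows "laplacian u x = \<phi>'' (norm x) + (real DIM('a) - 1) / norm x * \<phi>' (norm x)"
proof -
  define \<rho> where "\<rho> = norm x"
  have "\<rho> > 0" "\<rho> < R" using x by (auto simp: \<rho>_def)
  have second: "(deriv ^^ 2) (\<lambda>t. u (x + t *\<^sub>R b)) 0
      = \<phi>'' \<rho> * (x \<bullet> b / \<rho>)\<^sup>2 + \<phi>' \<rho> * (1 / \<rho> - (x \<bullet> b)\<^sup>2 / \<rho> ^ 3)" if b: "b \<in> Basis" for b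
  proof -
    define N where "N t = norm (x + t *\<^sub>R b)" for t
    have "N 0 = \<rho>" by (simp add: N_def \<rho>_def)
    have N_sqrt: "N t = sqrt (\<rho>\<^sup>2 + 2 * t * (x \<bullet> b) + t\<^sup>2)" for t
      using b by (simp add: N_def \<rho>_def norm_eq_sqrt_inner inner_simps inner_commute
          power2_eq_square algebra_simps)
    define U where "U = {t. 0 < N t \<and> N t < R}"
    have "open U"
      unfolding U_def N_def by (intro open_Collect_conj open_Collect_less continuous_intros)
    have "0 \<in> U" using \<open>\<rho> > 0\<close> \<open>\<rho> < R\<close> \<open>N 0 = \<rho>\<close> by (simp add: U_def)
    have N_deriv: "(N has_real_derivative (x \<bullet> b + t) / N t) (at t)" if "t \<in> U" for t
    proof -
      have "0 < \<rho>\<^sup>2 + 2 * t * (x \<bullet> b) + t\<^sup>2" using that N_sqrt[of t] by (auto simp: U_def)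
      then show ?thesis unfolding N_sqrt
        by (auto intro!: derivative_eq_intros simp: field_simps)
    qed
    have first: "((\<lambda>t. u (x + t *\<^sub>R b)) has_real_derivative \<phi>' (N t) * ((x \<bullet> b + t) / N t)) (at t)"
      if "t \<in> U" for t
    proof (rule has_field_derivative_transform_within_open[OF _ \<open>open U\<close> that])
      show "((\<lambda>t. \<phi> (N t)) has_real_derivative \<phi>' (N t) * ((x \<bullet> b + t) / N t)) (at t)"
        using that by (intro DERIV_chain2[OF \<phi>] N_deriv) (auto simp: U_def)
      show "\<phi> (N s) = u (x + s *\<^sub>R b)" if "s \<in> U" for s
        using that u[of "x + s *\<^sub>R b"] by (auto simp: U_def N_def)
    qed
    have "((\<lambda>t. \<phi>' (N t) * ((x \<bullet> b + t) / N t)) has_real_derivative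
        \<phi>'' (N 0) * ((x \<bullet> b + 0) / N 0) * ((x \<bullet> b + 0) / N 0) +
        (1 * N 0 - (x \<bullet> b + 0) * ((x \<bullet> b + 0) / N 0)) / (N 0 * N 0) * \<phi>' (N 0)) (at 0)"
      using \<open>0 \<in> U\<close> \<open>\<rho> > 0\<close> \<open>N 0 = \<rho>\<close>
      by (intro DERIV_mult DERIV_divide DERIV_chain2[OF \<phi>'] N_deriv)
        (auto simp: U_def intro!: derivative_eq_intros)
    then have "(deriv (\<lambda>t. u (x + t *\<^sub>R b)) has_real_derivative
        \<phi>'' (N 0) * ((x \<bullet> b + 0) / N 0) * ((x \<bullet> b + 0) / N 0) +
        (1 * N 0 - (x \<bullet> b + 0) * ((x \<bullet> b + 0) / N 0)) / (N 0 * N 0) * \<phi>' (N 0)) (at 0)"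
      by (rule has_field_derivative_transform_within_open[OF _ \<open>open U\<close> \<open>0 \<in> U\<close>])
        (simp add: DERIV_imp_deriv[OF first])
    from DERIV_imp_deriv[OF this] show ?thesis
      using \<open>\<rho> > 0\<close> \<open>N 0 = \<rho>\<close> by (simp add: numeral_2_eq_2 power3_eq_cube field_simps)
  qed
  have norm_sq: "(\<Sum>b\<in>Basis. (x \<bullet> b)\<^sup>2) = \<rho>\<^sup>2"
    unfolding \<rho>_def power2_norm_eq_inner euclidean_inner[of x x] by (simp add: power2_eq_square)
  have "laplacian u x
      = (\<Sum>b\<in>Basis. \<phi>'' \<rho> / \<rho>\<^sup>2 * (x \<bullet> b)\<^sup>2 + (\<phi>' \<rho> / \<rho> - \<phi>' \<rho> / \<rho> ^ 3 * (x \<bullet> b)\<^sup>2))"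
    unfolding laplacian_def by (intro sum.cong refl) (simp add: second power_divide algebra_simps)
  also have "\<dots> = \<phi>'' \<rho> / \<rho>\<^sup>2 * \<rho>\<^sup>2 + (real DIM('a) * (\<phi>' \<rho> / \<rho>) - \<phi>' \<rho> / \<rho> ^ 3 * \<rho>\<^sup>2)"
    unfolding sum.distrib sum_subtractf sum_distrib_left[symmetric] norm_sq by simp
  also have "\<dots> = \<phi>'' \<rho> + (real DIM('a) - 1) / \<rho> * \<phi>' \<rho>"
    using \<open>\<rho> > 0\<close> by (simp add: power2_eq_square power3_eq_cube field_simps)
  finally show ?thesis by (simp add: \<rho>_def)
qed

lemma V_weight_eq: "0 < r \<Longrightarrow> V_weight k r = (1 - ln r) powr (- 2 - k) / r\<^sup>2"
  using powr_minus_divide[of "1 - ln r" "2 + k"]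
  by (simp add: V_weight_def ln_div)

text \<open>In the plane ln r is harmonic, so \<phi>'' + \<phi>' / r is z''(s) / r^2 at s = 1 - ln
  r, without a first-order term. The profile extends beyond the boundary s = 1, so derivatives there
  are two-sided. Positivity of u is monotonicity of z.\<close>

lemma radial_solution_of_profile:
  assumes z: "solves_on k 0 z z'" "(z \<longlongrightarrow> b) at_top"
  defines "u \<equiv> \<lambda>x::real^2. (if norm x = 0 then b else z (1 - ln (norm x))) - z 1"
  shows "radial_solution (V_weight k) exp (exp (z 1)) u"
proof -
  define \<phi> where "\<phi> r = (if r = 0 then b else z (1 - ln r)) - z 1" for r
  define \<phi>' where "\<phi>' r = - z' (1 - ln r) / r" for r
  define \<phi>'' where "\<phi>'' r = (z' (1 - ln r) - (1 - ln r) powr (- 2 - k) * exp (z (1 - ln r))) / r\<^sup>2" for r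
  have pos: "0 < 1 - ln r" if "0 < r" "r \<le> 1" for r :: real
    using ln_le_zero_iff[OF that(1)] that(2) by linarith
  have s_deriv: "((\<lambda>r. 1 - ln r) has_real_derivative - (1 / r)) (at r)" if "0 < r" for r :: real
    using that by (auto intro!: derivative_eq_intros)
  have \<phi>: "(\<phi> has_real_derivative \<phi>' r) (at r)" if r: "0 < r" "r \<le> 1" for r
  proof (rule has_field_derivative_transform_within_open[of _ _ _ "{0<..}"])
    show "((\<lambda>r. z (1 - ln r) - z 1) has_real_derivative \<phi>' r) (at r)"
      by (rule DERIV_cong[OF DERIV_diff[OF
              DERIV_chain2[OF solves_onD(1)[OF z(1) pos[OF r]] s_deriv[OF r(1)]] DERIV_const]])
        (simp add: \<phi>'_def)
  qed (use r in \<open>auto simp: \<phi>_def\<close>)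
  have \<phi>': "(\<phi>' has_real_derivative \<phi>'' r) (at r)" if r: "0 < r" "r \<le> 1" for r
    unfolding \<phi>'_def
    by (rule DERIV_cong[OF DERIV_divide[OF DERIV_minus[OF
              DERIV_chain2[OF solves_onD(2)[OF z(1) pos[OF r]] s_deriv[OF r(1)]]] DERIV_ident]])
      (use r in \<open>simp_all add: \<phi>''_def power2_eq_square\<close>)
  have "continuous_on {0<..1} \<phi>''"
  proof -
    have cont: "continuous_on {0<..} z" "continuous_on {0<..} z'"
      using solves_onD[OF z(1)]
      by (auto intro!: DERIV_continuous_on intro: has_field_derivative_at_within)
    have s_cont: "continuous_on {0<..1} (\<lambda>r::real. 1 - ln r)"
      by (intro continuous_intros) auto
    have "(\<lambda>r::real. 1 - ln r) ` {0<..1} \<subseteq> {0<..}"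
      by (intro image_subsetI) (auto simp only: greaterThan_iff greaterThanAtMost_iff intro!: pos)
    then have "continuous_on {0<..1} (\<lambda>r. z (1 - ln r))" "continuous_on {0<..1} (\<lambda>r. z' (1 - ln r))"
      by (rule continuous_on_compose2[OF cont(1) s_cont] continuous_on_compose2[OF cont(2) s_cont])+
    moreover have "1 - ln r \<noteq> 0" if "r \<in> {0<..1}" for r :: real
      using pos[of r] that by (auto simp del: diff_gt_0_iff_gt)
    ultimately show ?thesis
      unfolding \<phi>''_def
      by (intro continuous_on_divide continuous_on_diff continuous_on_mult continuous_on_powr
          continuous_on_exp continuous_on_power continuous_on_const continuous_on_id s_cont) auto
  qed
  then have C2: "C2_on {0<..1} \<phi>"
    unfolding C2_on_def using \<phi> \<phi>'
    by (intro exI[of _ \<phi>'] exI[of _ \<phi>'']) (auto intro: has_field_derivative_at_within)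
  have "continuous_on {0..1} \<phi>"
    unfolding continuous_on_eq_continuous_within
  proof
    fix r :: real assume "r \<in> {0..1}"
    show "continuous (at r within {0..1}) \<phi>"
    proof (cases "r = 0")
      case False
      then show ?thesis using DERIV_isCont[OF \<phi>, of r] \<open>r \<in> {0..1}\<close>
        by (auto intro: continuous_at_imp_continuous_at_within)
    next
      case True
      have "filterlim (\<lambda>r::real. 1 + - ln r) at_top (at_right 0)"
        by (intro filterlim_tendsto_add_at_top[OF tendsto_const] filterlim_compose[OF filterlim_uminus_at_top_at_bot ln_at_0])
      from filterlim_compose[OF z(2) this]
      have "((\<lambda>r. z (1 - ln r) - z 1) \<longlongrightarrow> b - z 1) (at_right 0)" by (intro tendsto_intros) simp
      moreover have "at_right (0::real) = at 0 within {0..1}"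
        by (intro at_within_nhd[of _ "{..<1}"]) auto
      ultimately have "((\<lambda>r. z (1 - ln r) - z 1) \<longlongrightarrow> b - z 1) (at 0 within {0..1})" by simp
      then have "(\<phi> \<longlongrightarrow> b - z 1) (at 0 within {0..1})"
        by (rule Lim_transform_eventually) (auto simp: \<phi>_def eventually_at_filter)
      then show ?thesis using True by (simp add: continuous_within \<phi>_def)
    qed
  qed
  moreover have u: "u x = \<phi> (norm x)" for x by (simp add: u_def \<phi>_def)
  moreover have "- laplacian u x = exp (z 1) * V_weight k (norm x) * exp (u x)"
    if "x \<in> ball 0 1 - {0}" for x
  proof -
    have x: "0 < norm x" "norm x < 1" "x \<noteq> 0" using that by auto
    have "laplacian u x = \<phi>'' (norm x) + (real DIM(real^2) - 1) / norm x * \<phi>' (norm x)"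
      by (rule laplacian_radial[of 1]) (auto intro: \<phi> \<phi>' simp: u x)
    also have "\<dots> = - ((1 - ln (norm x)) powr (- 2 - k) * exp (z (1 - ln (norm x))) / (norm x)\<^sup>2)"
      using x by (simp add: \<phi>''_def \<phi>'_def power2_eq_square field_simps)
    finally show ?thesis
      using x by (simp add: V_weight_eq u \<phi>_def exp_diff)
  qed
  moreover have "0 < u x" if "x \<in> ball 0 1" for x
  proof (cases "x = 0")
    case True
    then show ?thesis using solves_on_less[OF z(1) _ z(2), of 1] by (simp add: u_def)
  next
    case False
    then have "1 < 1 - ln (norm x)" using that by simp
    then show ?thesis using solves_on_strict_mono[OF z(1) _ z(2), of 1] False by (simp add: u_def)
  qed
  moreover have "\<phi> 1 = 0" by (simp add: \<phi>_def)
  ultimately show ?thesis using C2 unfolding radial_solution_def by auto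
qed

text \<open>A radial solution is controlled only for r <= 1, so its profile solves the equation on s
  > 1 and the boundary value is recorded as a one-sided limit at s = 1.\<close>

lemma profile_of_radial_solution:
  assumes "radial_solution (V_weight k) exp l u"
  obtains z z' where "solves_on k 1 z z'" "(z \<longlongrightarrow> u 0 + ln l) at_top" "(z \<longlongrightarrow> ln l) (at_right 1)"
proof -
  obtain \<phi> where l: "0 < l" and u: "\<And>x. norm x \<le> 1 \<Longrightarrow> u x = \<phi> (norm x)"
    and cont: "continuous_on {0..1} \<phi>" and C2: "C2_on {0<..1} \<phi>"
    and pde: "\<And>x. norm x < 1 \<Longrightarrow> x \<noteq> 0 \<Longrightarrow> - laplacian u x = l * V_weight k (norm x) * exp (u x)"
    and bdry: "\<And>x. norm x = 1 \<Longrightarrow> u x = 0"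
    using assms unfolding radial_solution_def by (auto simp: dist_norm)
  obtain \<phi>' \<phi>''
    where \<phi>_within: "\<And>r. r \<in> {0<..1} \<Longrightarrow> (\<phi> has_real_derivative \<phi>' r) (at r within {0<..1})"
      and \<phi>'_within: "\<And>r. r \<in> {0<..1} \<Longrightarrow> (\<phi>' has_real_derivative \<phi>'' r) (at r within {0<..1})"
    using C2 unfolding C2_on_def by blast
  have at: "at r within {0<..1} = at r" if "0 < r" "r < 1" for r :: real
    using that by (intro at_within_open_subset[of _ "{0<..<1}"]) auto
  have \<phi>: "(\<phi> has_real_derivative \<phi>' r) (at r)" if "0 < r" "r < 1" for r
    using \<phi>_within[of r] that by (simp add: at)
  have \<phi>': "(\<phi>' has_real_derivative \<phi>'' r) (at r)" if "0 < r" "r < 1" for r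
    using \<phi>'_within[of r] that by (simp add: at)
  have ode: "\<phi>'' r + \<phi>' r / r = - (l * V_weight k r * exp (\<phi> r))" if r: "0 < r" "r < 1" for r
  proof -
    obtain x :: "real^2" where x: "norm x = r" using vector_choose_size[of r] r by auto
    have "x \<noteq> 0" using x r by auto
    have "laplacian u x = \<phi>'' (norm x) + (real DIM(real^2) - 1) / norm x * \<phi>' (norm x)"
      using x r \<open>x \<noteq> 0\<close> by (intro laplacian_radial[of 1 \<phi>] \<phi> \<phi>' u) auto
    then show ?thesis using pde[of x] x r \<open>x \<noteq> 0\<close> u[of x] by simp
  qed
  define z where "z s = \<phi> (exp (1 - s)) + ln l" for s
  define z' where "z' s = - \<phi>' (exp (1 - s)) * exp (1 - s)" for s
  have "solves_on k 1 z z'"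
    unfolding solves_on_def
  proof (intro allI impI conjI)
    fix s :: real assume "1 < s"
    define r where "r = exp (1 - s)"
    have r: "0 < r" "r < 1" "ln r = 1 - s" using \<open>1 < s\<close> by (auto simp: r_def)
    have r_deriv: "((\<lambda>s. exp (1 - s)) has_real_derivative - r) (at s)"
      unfolding r_def by (auto intro!: derivative_eq_intros)
    show "(z has_real_derivative z' s) (at s)"
      unfolding z_def z'_def using DERIV_chain2[OF \<phi> r_deriv] r
      by (auto intro!: derivative_eq_intros simp: r_def)
    have "(z' has_real_derivative r\<^sup>2 * (\<phi>'' r + \<phi>' r / r)) (at s)"
      unfolding z'_def using DERIV_chain2[OF \<phi>' r_deriv] r r_deriv
      by (auto intro!: derivative_eq_intros simp: r_def power2_eq_square field_simps)
    then show "(z' has_real_derivative - (s powr (- 2 - k) * exp (z s))) (at s)"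
      using r l by (simp add: ode V_weight_eq z_def exp_add mult_ac flip: r_def)
  qed
  moreover have "(z \<longlongrightarrow> u 0 + ln l) at_top"
  proof -
    have "filterlim (\<lambda>s::real. 1 - s) at_bot at_top"
      using filterlim_tendsto_add_at_top[OF tendsto_const[of "- 1::real"] filterlim_ident]
      unfolding filterlim_uminus_at_bot by simp
    from filterlim_compose[OF exp_at_bot this]
    have "((\<lambda>s::real. exp (1 - s)) \<longlongrightarrow> 0) at_top" .
    moreover have "\<forall>\<^sub>F s in at_top. exp (1 - s) \<in> {0..1::real}"
      by (rule eventually_mono[OF eventually_ge_at_top[of 1]]) auto
    ultimately have "((\<lambda>s. \<phi> (exp (1 - s))) \<longlongrightarrow> \<phi> 0) at_top"
      by (intro continuous_on_tendsto_compose[OF cont]) auto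
    then show ?thesis unfolding z_def using u[of 0] by (auto intro!: tendsto_intros)
  qed
  moreover have "(z \<longlongrightarrow> ln l) (at_right 1)"
  proof -
    have "((\<lambda>s::real. exp (1 - s)) \<longlongrightarrow> exp (1 - 1)) (at_right 1)" by (intro tendsto_intros)
    moreover have "\<forall>\<^sub>F s in at_right 1. exp (1 - s) \<in> {0..1::real}"
      by (auto simp: eventually_at_filter)
    ultimately have "((\<lambda>s. \<phi> (exp (1 - s))) \<longlongrightarrow> \<phi> 1) (at_right 1)"
      by (intro continuous_on_tendsto_compose[OF cont]) auto
    moreover have "\<phi> 1 = 0"
      using vector_choose_size[of 1, where 'a="real^2"] u bdry by force
    ultimately show ?thesis unfolding z_def by (auto intro: tendsto_add[of _ 0, simplified])
  qed
  ultimately show thesis by (rule that)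
qed

text \<open>Scaling \<open>s\<close> shifts the value at infinity, so one profile yields the whole curve.\<close>

lemma solves_on_scale:
  assumes "solves_on k 0 z z'" "0 < c"
  shows "solves_on k 0 (\<lambda>s. z (c * s) - k * ln c) (\<lambda>s. c * z' (c * s))"
  unfolding solves_on_def
proof (intro allI impI conjI)
  fix s :: real assume "0 < s"
  then have cs: "0 < c * s" using assms(2) by simp
  have lin: "((\<lambda>s. c * s) has_real_derivative c) (at s)" by (auto intro!: derivative_eq_intros)
  show "((\<lambda>s. z (c * s) - k * ln c) has_real_derivative c * z' (c * s)) (at s)"
    using DERIV_chain2[OF solves_onD(1)[OF assms(1) cs] lin]
    by (auto intro!: derivative_eq_intros)
  have "exp (z (c * s) - k * ln c) = exp (z (c * s)) * c powr (- k)"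
    using assms(2) by (simp add: exp_diff powr_def exp_minus divide_inverse)
  moreover have "c * (c * (c * s) powr (- 2 - k)) = s powr (- 2 - k) * c powr (- k)"
    using assms(2) \<open>0 < s\<close> by (simp add: powr_mult powr_diff powr_minus powr_neg_numeral power2_eq_square field_simps)
  ultimately have "c * (- ((c * s) powr (- 2 - k) * exp (z (c * s))) * c)
      = - (s powr (- 2 - k) * exp (z (c * s) - k * ln c))" by (simp add: algebra_simps)
  then show "((\<lambda>s. c * z' (c * s)) has_real_derivative
      - (s powr (- 2 - k) * exp (z (c * s) - k * ln c))) (at s)"
    using DERIV_cmult[OF DERIV_chain2[OF solves_onD(2)[OF assms(1) cs] lin], of c] by metis
qed

text \<open>The scaled profile \<open>y\<close> gives one radial solution with parameter \<beta>.
  Any other one has a profile equal to \<open>y\<close> on s > 1, hence the same boundary limit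
  \<open>y 1 = ln l\<close>, so both descriptions denote.\<close>

lemma bifurcation_curve:
  assumes "k > 0" and z: "solves_on k 0 z z'" "(z \<longlongrightarrow> 0) at_top"
  shows "bif_lambda (V_weight k) exp \<beta> = exp (z (exp (- \<beta> / k)) + \<beta>)"
    and "bif_alpha (V_weight k) exp \<beta> = - z (exp (- \<beta> / k))"
proof -
  \<comment> \<open>Scaling by c shifts the limit by - k ln c, which has to be \<beta>.\<close>
  define c where "c = exp (- (\<beta> / k))"
  have "c > 0" "k * ln c = - \<beta>" using assms(1) by (auto simp: c_def)
  define y where "y s = z (c * s) + \<beta>" for s
  define y' where "y' s = c * z' (c * s)" for s
  have y: "solves_on k 0 y y'"
    using solves_on_scale[OF z(1) \<open>c > 0\<close>] \<open>k * ln c = - \<beta>\<close> unfolding y_def y'_def by simp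
  have y_lim: "(y \<longlongrightarrow> \<beta>) at_top"
  proof -
    have "filterlim (\<lambda>s. c * s) at_top at_top"
      using \<open>c > 0\<close> by (intro filterlim_tendsto_pos_mult_at_top[OF tendsto_const] filterlim_ident)
    from tendsto_add[OF filterlim_compose[OF z(2) this] tendsto_const[of \<beta>]]
    show ?thesis unfolding y_def by simp
  qed
  have unique: "ln l = y 1 \<and> u 0 = - z c"
    if sol: "radial_solution (V_weight k) exp l u" and eq: "u 0 + ln l = \<beta>" for l u
  proof -
    obtain v v' where v: "solves_on k 1 v v'" "(v \<longlongrightarrow> u 0 + ln l) at_top" "(v \<longlongrightarrow> ln l) (at_right 1)"
      using profile_of_radial_solution[OF sol] .
    have "solves_on k 1 y y'" using y by (auto simp: solves_on_def)
    then have "v s = y s" if "1 < s" for s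
      using solves_on_unique[OF assms(1) _ v(1) v(2) _ _ that, of y y'] y_lim eq by simp
    then have "\<forall>\<^sub>F s in at_right 1. v s = y s" by (auto simp: eventually_at_filter)
    then have "(y \<longlongrightarrow> ln l) (at_right 1)" by (rule Lim_transform_eventually[OF v(3)])
    moreover have "(y \<longlongrightarrow> y 1) (at_right 1)"
      using DERIV_isCont[OF solves_onD(1)[OF y, of 1]]
      by (auto simp: isCont_def intro: tendsto_within_subset)
    ultimately have "ln l = y 1" by (rule tendsto_unique[rotated]) simp
    then show ?thesis using eq by (simp add: y_def)
  qed
  obtain u where u: "radial_solution (V_weight k) exp (exp (y 1)) u" "u 0 = \<beta> - y 1"
    using radial_solution_of_profile[OF y y_lim] by simp
  show "bif_lambda (V_weight k) exp \<beta> = exp (z (exp (- \<beta> / k)) + \<beta>)"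
    unfolding bif_lambda_def
  proof (rule the_equality)
    show "\<exists>u. radial_solution (V_weight k) exp (exp (z (exp (- \<beta> / k)) + \<beta>)) u
        \<and> u 0 + ln (exp (z (exp (- \<beta> / k)) + \<beta>)) = \<beta>"
      using u by (intro exI[of _ u]) (simp add: y_def flip: c_def)
  next
    fix l assume "\<exists>u. radial_solution (V_weight k) exp l u \<and> u 0 + ln l = \<beta>"
    then obtain u where "radial_solution (V_weight k) exp l u" "u 0 + ln l = \<beta>" by blast
    then have "ln l = y 1" "0 < l" using unique by (auto simp: radial_solution_def)
    then show "l = exp (z (exp (- \<beta> / k)) + \<beta>)"
      using exp_ln[of l] by (simp add: y_def flip: c_def)
  qed
  show "bif_alpha (V_weight k) exp \<beta> = - z (exp (- \<beta> / k))"
    unfolding bif_alpha_def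
  proof (rule the_equality)
    show "\<exists>l u. radial_solution (V_weight k) exp l u \<and> u 0 + ln l = \<beta> \<and> - z (exp (- \<beta> / k)) = u 0"
      using u by (intro exI[of _ "exp (y 1)"] exI[of _ u]) (simp add: y_def flip: c_def)
  qed (use unique in \<open>auto simp flip: c_def\<close>)
qed

section \<open>Shape of the curve\<close>

lemma strict_mono_not_local_extremum:
  assumes "strict_mono g"
  shows "\<not> local_extremum g b"
proof -
  have "\<not> (\<forall>\<^sub>F x in nhds b. g x \<le> g b)"
  proof
    assume "\<forall>\<^sub>F x in nhds b. g x \<le> g b"
    then obtain d where d: "0 < d" "\<And>x. dist x b < d \<Longrightarrow> g x \<le> g b"
      unfolding eventually_nhds_metric by blast
    have "g (b + d / 2) \<le> g b" using d(1) by (intro d(2)) (simp add: dist_real_def)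
    then show False using d(1) strict_monoD[OF assms, of b "b + d / 2"] by simp
  qed
  moreover have "\<not> (\<forall>\<^sub>F x in nhds b. g b \<le> g x)"
  proof
    assume "\<forall>\<^sub>F x in nhds b. g b \<le> g x"
    then obtain d where d: "0 < d" "\<And>x. dist x b < d \<Longrightarrow> g b \<le> g x"
      unfolding eventually_nhds_metric by blast
    have "g b \<le> g (b - d / 2)" using d(1) by (intro d(2)) (simp add: dist_real_def)
    then show False using d(1) strict_monoD[OF assms, of "b - d / 2" b] by simp
  qed
  ultimately show ?thesis by (simp add: local_extremum_def)
qed

lemma oscillating_imp_changes_sign:
  assumes pos: "\<And>T. \<exists>t>T. 0 < g t" and neg: "\<And>T. \<exists>t>T. g t < 0"
  shows "changes_sign_infinitely_often g"
proof -
  define P where "P n x \<longleftrightarrow> (if even n then 0 < g x else g x < 0)" for n :: nat and x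
  have "\<exists>s. \<forall>n. P n (s n) \<and> s n < s (Suc n)"
  proof (rule dependent_nat_choice)
    show "\<exists>x. P 0 x" using pos by (auto simp: P_def)
    show "\<exists>y. P (Suc n) y \<and> x < y" if "P n x" for x n
      using pos[of x] neg[of x] by (auto simp: P_def)
  qed
  then obtain s where s: "\<And>n. P n (s n)" "\<And>n. s n < s (Suc n)" by blast
  have "g (s n) * g (s (Suc n)) < 0" for n
    using s(1)[of n] s(1)[of "Suc n"] by (auto simp: P_def mult_less_0_iff split: if_splits)
  moreover have "strict_mono s" using s(2) by (simp add: strict_mono_Suc_iff)
  ultimately show ?thesis unfolding changes_sign_infinitely_often_def by blast
qed

text \<open>On an interval whose end values are below c and which contains a value above c, the
  maximum is interior. Such intervals exist arbitrarily far to the right.\<close>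

lemma oscillating_imp_infinite_local_extrema:
  fixes g :: "real \<Rightarrow> real"
  assumes cont: "continuous_on UNIV g"
    and pos: "\<And>T. \<exists>t>T. c < g t" and neg: "\<And>T. \<exists>t>T. g t < c"
  shows "infinite {b. local_extremum g b}"
proof -
  have "\<exists>b>T. local_extremum g b" for T
  proof -
    obtain t1 where t1: "T < t1" "g t1 < c" using neg by blast
    obtain t2 where t2: "t1 < t2" "c < g t2" using pos by blast
    obtain t3 where t3: "t2 < t3" "g t3 < c" using neg by blast
    obtain b where b: "b \<in> {t1..t3}" "\<And>x. x \<in> {t1..t3} \<Longrightarrow> g x \<le> g b"
      using continuous_attains_sup[of "{t1..t3}" g] continuous_on_subset[OF cont] t2 t3 by force
    have "g t2 \<le> g b" using b(2)[of t2] t2 t3 by simp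
    then have "b \<noteq> t1" "b \<noteq> t3" using t1 t2 t3 by auto
    then have "b \<in> {t1<..<t3}" using b(1) by auto
    then have "\<forall>\<^sub>F x in nhds b. x \<in> {t1<..<t3}" by (intro eventually_nhds_in_open) auto
    then have "\<forall>\<^sub>F x in nhds b. g x \<le> g b" by (rule eventually_mono) (simp add: b(2))
    moreover have "T < b" using b(1) t1(1) by simp
    ultimately show ?thesis by (auto simp: local_extremum_def)
  qed
  then have "\<not> bdd_above {b. local_extremum g b}"
    by (auto simp: bdd_above_def not_le)
  then show ?thesis by (rule contrapos_nn) (rule bdd_above_finite)
qed

text \<open>Turning points are points of the curve, not parameters; injectivity of A keeps distinct
  extrema from giving the same point.\<close>

lemma infinite_turning_points:
  assumes "inj A" "infinite {b. local_extremum L b}"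
  shows "infinite (turning_points L A)"
proof -
  have "turning_points L A = (\<lambda>b. (L b, A b)) ` {b. local_extremum L b}"
    by (auto simp: turning_points_def)
  moreover have "inj (\<lambda>b. (L b, A b))" using assms(1) by (auto simp: inj_def)
  ultimately show ?thesis
    using assms(2) finite_imageD inj_on_subset by (metis subset_UNIV)
qed

lemma inj_imp_globally_parameterized:
  assumes "inj A"
  shows "globally_parameterized_by_alpha L A"
  unfolding globally_parameterized_by_alpha_def
  by (rule exI[of _ "\<lambda>a. L (inv A a)"], rule exI[of _ "range A"]) (auto simp: assms)

text \<open>Monotonicity of A turns a lower bound on A \<beta> into a lower bound on \<beta>, so the
  limit along large A follows from the limit along large \<beta>.\<close>

lemma converges_to_lineI:
  assumes "mono A" "filterlim A at_top at_top" "(L \<longlongrightarrow> l) at_top"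
  shows "converges_to_line L A l"
proof -
  have "filtercomap A at_top \<le> at_top"
    unfolding le_filter_def
  proof (intro allI impI)
    fix P :: "real \<Rightarrow> bool" assume "eventually P at_top"
    then obtain N where N: "\<And>x. N \<le> x \<Longrightarrow> P x" by (auto simp: eventually_at_top_linorder)
    have "P x" if "A N < A x" for x
      using N monoD[OF assms(1), of x N] that by force
    then show "eventually P (filtercomap A at_top)"
      unfolding eventually_filtercomap using eventually_gt_at_top[of "A N"] by blast
  qed
  then show ?thesis
    using assms(2) tendsto_mono[OF _ assms(3)] by (simp add: converges_to_line_def)
qed

text \<open>By scale invariance, adding k t makes the equation autonomous in t = - ln s: it absorbs
  the factor s^(-k) of the exponential term. Subtracting ln k moves the equilibrium to 0.\<close>

lemma damped_oscillator_of_profile: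
  assumes "k > 0" and z: "solves_on k 0 z z'"
  shows "damped_oscillator k (\<lambda>t. z (exp (- t)) + k * t - ln k) (\<lambda>t. k - exp (- t) * z' (exp (- t)))"
proof
  fix t
  have e: "((\<lambda>t. exp (- t)) has_real_derivative - exp (- t)) (at t)" by (auto intro!: derivative_eq_intros)
  note z_deriv = DERIV_chain2[OF solves_onD(1)[OF z] e] and z'_deriv = DERIV_chain2[OF solves_onD(2)[OF z] e]
  show "((\<lambda>t. z (exp (- t)) + k * t - ln k) has_real_derivative k - exp (- t) * z' (exp (- t))) (at t)"
    by (auto intro!: derivative_eq_intros z_deriv)
  have "exp (- t) * (exp (- t) * exp (- t) powr (- 2 - k)) = exp (k * t)"
    by (simp add: powr_def flip: exp_add) (simp add: algebra_simps)
  moreover have "exp (z (exp (- t)) + k * t - ln k) = exp (k * t) * exp (z (exp (- t))) / k"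
    using assms(1) by (simp add: exp_add exp_diff)
  ultimately have "k * exp (z (exp (- t)) + k * t - ln k)
      = exp (- t) * (exp (- t) * (exp (- t) powr (- 2 - k) * exp (z (exp (- t)))))"
    using assms(1) by (simp add: algebra_simps)
  then show "((\<lambda>t. k - exp (- t) * z' (exp (- t))) has_real_derivative
      - (k - exp (- t) * z' (exp (- t))) - k * (exp (z (exp (- t)) + k * t - ln k) - 1)) (at t)"
    by (intro DERIV_cong[OF DERIV_diff[OF DERIV_const DERIV_mult[OF e z'_deriv]]])
      (simp_all add: algebra_simps)
qed (fact assms(1))

theorem theorem1p5:
  fixes k :: real
  assumes "k > 0"
  defines "L \<equiv> bif_lambda (V_weight k) exp"
    and "A \<equiv> bif_alpha (V_weight k) exp"
  shows "(k > 1/4 \<longrightarrow> type_I L A) \<and>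
         (k \<le> 1/4 \<longrightarrow> type_II L A) \<and>
         (k \<le> 1/4 \<longrightarrow> globally_parameterized_by_alpha L A)"
proof -
  obtain z z' where z: "solves_on k 0 z z'" "(z \<longlongrightarrow> 0) at_top"
    using solution_exists[OF assms(1)] .
  have L: "L \<beta> = exp (z (exp (- (\<beta> / k))) + \<beta>)" and A: "A \<beta> = - z (exp (- (\<beta> / k)))" for \<beta>
    using bifurcation_curve[OF assms(1) z] by (simp_all add: L_def A_def)
  define w where "w t = z (exp (- t)) + k * t - ln k" for t
  define w' where "w' t = k - exp (- t) * z' (exp (- t))" for t
  interpret damped_oscillator k w w'
    using damped_oscillator_of_profile[OF assms(1) z(1)] unfolding w_def w'_def .
  have L_w: "L \<beta> = k * exp (w (\<beta> / k))" for \<beta>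
    using assms(1) by (simp add: L w_def exp_add exp_diff)
  have "strict_mono A"
    using solves_on_strict_mono[OF z(1) _ z(2)] assms(1)
    by (auto intro!: strict_monoI simp: A divide_strict_right_mono)
  then have "inj A" "mono A" by (auto simp: strict_mono_imp_inj_on strict_mono_mono)

  have exp_lim: "filterlim (\<lambda>t::real. exp (- t)) at_top at_bot"
    by (intro filterlim_compose[OF exp_at_top] filterlim_uminus_at_top_at_bot)
  have z_lim: "((\<lambda>t. z (exp (- t))) \<longlongrightarrow> 0) at_bot" by (rule filterlim_compose[OF z(2) exp_lim])
  have scale_bot: "filterlim (\<lambda>\<beta>. \<beta> / k) at_bot at_bot"
    using filterlim_tendsto_pos_mult_at_bot[OF tendsto_const[of "1 / k"] _ filterlim_ident] assms(1) by simp
  have scale_top: "filterlim (\<lambda>\<beta>. \<beta> / k) at_top at_top"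
    using filterlim_tendsto_pos_mult_at_top[OF tendsto_const[of "1 / k"] _ filterlim_ident] assms(1) by simp
  have z_lim_\<beta>: "((\<lambda>\<beta>. z (exp (- (\<beta> / k)))) \<longlongrightarrow> 0) at_bot"
    using filterlim_compose[OF z_lim scale_bot] by simp
  have "((\<lambda>\<beta>. exp (z (exp (- (\<beta> / k)))) * exp \<beta>) \<longlongrightarrow> exp 0 * 0) at_bot"
    by (intro tendsto_intros z_lim_\<beta> exp_at_bot)
  then have emanates: "emanates_from_origin L A"
    unfolding emanates_from_origin_def using tendsto_minus[OF z_lim_\<beta>]
    by (simp flip: exp_add L A)

  have "((\<lambda>\<beta>. k * exp (w (\<beta> / k))) \<longlongrightarrow> k * exp 0) at_top"
    by (intro tendsto_intros filterlim_compose[OF w_tendsto_0 scale_top])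
  then have L_lim: "(L \<longlongrightarrow> k) at_top" by (simp flip: L_w)
  \<comment> \<open>\<alpha> = \<beta> - ln \<lambda>, and ln \<lambda> converges to ln k.\<close>
  have "filterlim (\<lambda>\<beta>. - ln (L \<beta>) + \<beta>) at_top at_top"
    by (intro filterlim_tendsto_add_at_top[OF tendsto_minus[OF tendsto_ln[OF L_lim]]] filterlim_ident)
      (use assms(1) in auto)
  moreover have "- ln (L \<beta>) + \<beta> = A \<beta>" for \<beta> by (simp add: L A)
  ultimately have "filterlim A at_top at_top" by simp
  then have converges: "converges_to_line L A k"
    by (intro converges_to_lineI \<open>mono A\<close> L_lim)

  have w_bot: "filterlim w at_bot at_bot"
  proof -
    have "filterlim (\<lambda>t. k * t) at_bot at_bot"
      using assms(1) by (intro filterlim_tendsto_pos_mult_at_bot[OF tendsto_const] filterlim_ident)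
    moreover have "((\<lambda>t. z (exp (- t)) - ln k) \<longlongrightarrow> 0 - ln k) at_bot"
      by (intro tendsto_intros z_lim)
    ultimately have "filterlim (\<lambda>t. (z (exp (- t)) - ln k) + k * t) at_bot at_bot"
      by (rule filterlim_tendsto_add_at_bot_iff[THEN iffD2, rotated])
    then show ?thesis unfolding w_def by (simp add: algebra_simps)
  qed
  have "type_I L A" if "k > 1/4"
  proof -
    have "\<forall>\<^sub>F t in at_bot. w t < 0" using w_bot unfolding filterlim_at_bot_dense by blast
    then obtain t0 where "w t0 < 0" by (auto simp: eventually_at_bot_linorder)
    then have "w t0 \<noteq> 0" by simp
    have sign: "\<exists>\<beta>>T. \<sigma> * (L \<beta> - k) < 0" if \<sigma>: "\<sigma> = 1 \<or> \<sigma> = -1" for T \<sigma> :: real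
    proof -
      obtain t where t: "T / k < t" "\<sigma> * w t < 0"
        using oscillates[OF \<open>k > 1/4\<close> \<open>w t0 \<noteq> 0\<close> \<sigma>] by blast
      have "L (k * t) - k = k * (exp (w t) - 1)" using assms(1) by (simp add: L_w algebra_simps)
      then show ?thesis
        using t assms(1) \<sigma>
        by (intro exI[of _ "k * t"])
          (auto simp: mult_less_0_iff zero_less_mult_iff pos_divide_less_eq mult.commute)
    qed
    have neg: "\<exists>\<beta>>T. L \<beta> < k" and pos: "\<exists>\<beta>>T. k < L \<beta>" for T
      using sign[of 1 T] sign[of "-1" T] by auto
    have "continuous_on UNIV w"
      using DERIV_continuous_on[OF w_deriv] .
    then have "continuous_on UNIV L"
      unfolding L_w by (intro continuous_intros continuous_on_compose2[OF \<open>continuous_on UNIV w\<close>]) (use assms(1) in auto)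
    then have "infinite (turning_points L A)"
      using neg pos by (intro infinite_turning_points \<open>inj A\<close> oscillating_imp_infinite_local_extrema)
    moreover have "changes_sign_infinitely_often (\<lambda>\<beta>. L \<beta> - k)"
      using neg pos by (intro oscillating_imp_changes_sign) auto
    ultimately show ?thesis
      unfolding type_I_def using emanates converges assms(1) by blast
  qed
  moreover have "type_II L A" if "k \<le> 1/4"
  proof -
    have "0 < z' (exp (- t))" for t by (rule solves_on_deriv(1)[OF z(1) _ z(2)]) auto
    then have bound: "w' t \<le> k" for t by (simp add: w'_def less_imp_le)
    \<comment> \<open>As t tends to minus infinity, s = exp (- t) tends to infinity, where z'
      vanishes.\<close>
    have "((\<lambda>t. k * exp t - z' (exp (- t))) \<longlongrightarrow> k * 0 - 0) at_bot"
      by (intro tendsto_intros exp_at_bot filterlim_compose[OF solves_on_deriv(2)[OF z(1) _ z(2)] exp_lim]) simp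
    moreover have "w' t * exp t = k * exp t - z' (exp (- t))" for t
      by (simp add: w'_def algebra_simps exp_minus)
    ultimately have "((\<lambda>t. w' t * exp t) \<longlongrightarrow> 0) at_bot" by simp
    then have "0 < w' t" for t by (rule overdamped_increasing[OF that w_bot bound])
    then have "w x < w y" if "x < y" for x y
      using DERIV_pos_imp_increasing[OF that, of w] w_deriv by blast
    then have "strict_mono L"
      using assms(1) by (auto intro!: strict_monoI simp: L_w divide_strict_right_mono)
    then have "mono L" "turning_points L A = {}"
      by (auto simp: strict_mono_mono turning_points_def strict_mono_not_local_extremum)
    then show ?thesis unfolding type_II_def using emanates converges assms(1) by blast
  qed
  ultimately show ?thesis using inj_imp_globally_parameterized[OF \<open>inj A\<close>] by blast
qed

end
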